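(* Let $\alpha$ be a $\mathbf{cds}$-non-sortable permutation (equivalently, one with nonempty strategic pile), and let $\mathsf{P}$ be the strategic pile of $\alpha$. Let $j\in\{0,1,2,3\}$ with $|\mathsf{P}| \bmod 4 = j$. (1)(a) If $j<2$, then for any $\mathsf{A}\subseteq\mathsf{P}$ with $|\mathsf{A}|\ge \frac34(|\mathsf{P}|-j)+j$, ONE has a winning strategy in $\mathsf{CDS}(\alpha,\mathsf{A})$. (1)(b) If $j\ge 2$, then for any $\mathsf{A}\subseteq\mathsf{P}$ with $|\mathsf{A}|\ge \frac34(|\mathsf{P}|-j)+(j-1)$, ONE has a winning strategy in $\mathsf{CDS}(\alpha,\mathsf{A})$. (2) For any $\mathsf{A}\subseteq\mathsf{P}$ with $|\mathsf{P}\setminus\mathsf{A}|\ge \frac34(|\mathsf{P}|-j)+j$, TWO has a winning strategy in $\mathsf{CDS}(\alpha,\mathsf{A})$.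
   Context: **Permutations and pointers.** $\mathsf{S}_n$ is the set of permutations of $\{1,\dots,n\}$, written as lists $\alpha=[a_1,\dots,a_n]$; all permutations considered lie in some $\mathsf{S}_n$. An entry $k$ of $\alpha$ has a head pointer $(k,k+1)$, placed immediately to the right of $k$, and a tail pointer $(k-1,k)$, placed immediately to the left of $k$. The pointers $(0,1)$ and $(n,n+1)$ are disregarded, so $\alpha$ has the $n-1$ pointers $(i,i+1)$, $1\le i\le n-1$, each occurring exactly twice: just to the right of $i$ and just to the left of $i+1$. In the gap between two consecutive entries $e,f$, the head pointer of $e$ comes before the tail pointer of $f$. Two distinct pointers $p,q$ interlock in $\alpha$ if their four occurrences appear, from left to right, in the order $p\ldots q\ldots p\ldots q$ or $q\ldots p\ldots q\ldots p$. **The sorting operation cds.** If $p$ and $q$ interlock in $\alpha$, the four occurrences of $p$ and $q$ cut the list $\alpha$ into five consecutive (possibly empty) blocks of entries $\alpha=A\,B\,C\,D\,E$ ($B$ between the first and second occurrences, $C$ between the second and third, $D$ between the third and fourth), and $\mathbf{cds}_{p,q}(\alpha)$ is the permutation $A\,D\,C\,B\,E$. If $p,q$ do not interlock, $\mathbf{cds}_{p,q}(\alpha)$ is undefined. A $\mathbf{cds}$ fixed point is a permutation with no interlocking pair of pointers; the fixed points in $\mathsf{S}_n$ are the identity and the permutations $[i,i+1,\dots,n,1,2,\dots,i-1]$ for $2\le i\le n$; the code of the latter is the pointer $(i-1,i)$. A permutation is $\mathbf{cds}$-sortable if the identity can be reached from it by applications of $\mathbf{cds}$. **Cycle graph and strategic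 pile.** The cycle graph of $\alpha=[a_1,\dots,a_n]$ has vertices $0,1,\dots,n+1$; a dotted directed edge from $i$ to $i+1$ for each $0\le i\le n$; and, with $a_0=0$, $a_{n+1}=n+1$, a black directed edge from $a_k$ to $a_{k-1}$ for each $1\le k\le n+1$. The edge set decomposes uniquely into edge-disjoint directed alternating cycles (cycles in which dotted and black edges alternate). If the dotted edges $n\to n+1$ and $0\to1$ lie on the same alternating cycle, the strategic pile of $\alpha$ is the set of pointers $(i,i+1)$, $1\le i\le n-1$, such that the dotted edge $i\to i+1$ lies on the directed alternating path that starts with the dotted edge $n\to n+1$ and follows the cycle to the dotted edge $0\to1$; otherwise the strategic pile is empty. It is known that $\alpha$ is $\mathbf{cds}$-sortable if and only if its strategic pile is empty, and that for $2\le i\le n$ the fixed point $[i,\dots,n,1,\dots,i-1]$ is reachable from $\alpha$ by $\mathbf{cds}$ operations if and only if $(i-1,i)$ is in the strategic pile. **The game $\mathsf{CDS}(\alpha,\mathsf{A})$.** Here $\alpha$ is a $\mathbf{cds}$-non-sortable permutation with strategic pile $\mathsf{P}$, and $\mathsf{A}\subseteq\mathsf{P}$. Starting from $\alpha$, players ONE and TWO alternate, ONE moving first; each move consists of applying some $\mathbf{cds}_{p,q}$, with $p,q$ interlocking in the current permutation, to the current permutation. The game ends when a $\mathbf{cds}$ fixed point is reached. If the code of this fixed point (necessarily an element of $\mathsf{P}$) is in $\mathsf{A}$, ONE wins; otherwise TWO wins. *)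

theory Defs
  imports "HOL-Combinatorics.Combinatorics" Complex_Main
begin

type_synonym ptr = "nat \<times> nat"

definition pointers :: "nat list \<Rightarrow> ptr set" where
  "pointers \<alpha> = {(i, Suc i) | i. 1 \<le> i \<and> i < length \<alpha>}"

datatype item = Entry nat | Ptr ptr

text \<open>The list with every entry \<open>k\<close> surrounded by its tail pointer and its head pointer.
  The disregarded pointers \<open>(0, 1)\<close> and \<open>(n, n + 1)\<close> are still present here; they are excluded
  by the restriction to \<^const>\<open>pointers\<close> below.\<close>

definition marked :: "nat list \<Rightarrow> item list" where
  "marked \<alpha> = concat (map (\<lambda>k. [Ptr (k - 1, k), Entry k, Ptr (k, k + 1)]) \<alpha>)"

fun entries :: "item list \<Rightarrow> nat list" where
  "entries [] = []"
| "entries (Entry k # xs) = k # entries xs"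
| "entries (Ptr p # xs) = entries xs"

definition interlock_order :: "ptr \<Rightarrow> ptr \<Rightarrow> nat list \<Rightarrow>
    item list \<Rightarrow> item list \<Rightarrow> item list \<Rightarrow> item list \<Rightarrow> item list \<Rightarrow> bool" where
  "interlock_order p q \<alpha> A B C D E \<longleftrightarrow>
     p \<in> pointers \<alpha> \<and> q \<in> pointers \<alpha> \<and> p \<noteq> q \<and>
     marked \<alpha> = A @ [Ptr p] @ B @ [Ptr q] @ C @ [Ptr p] @ D @ [Ptr q] @ E"

definition interlock :: "ptr \<Rightarrow> ptr \<Rightarrow> nat list \<Rightarrow> bool" where
  "interlock p q \<alpha> \<longleftrightarrow>
     (\<exists>A B C D E. interlock_order p q \<alpha> A B C D E \<or> interlock_order q p \<alpha> A B C D E)"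

text \<open>\<open>cds p q \<alpha> \<beta>\<close> says that the partial operation \<open>cds\<^bsub>p,q\<^esub>\<close> is defined at \<open>\<alpha>\<close> and
  has the value \<open>\<beta>\<close> there.\<close>

definition cds :: "ptr \<Rightarrow> ptr \<Rightarrow> nat list \<Rightarrow> nat list \<Rightarrow> bool" where
  "cds p q \<alpha> \<beta> \<longleftrightarrow>
     (\<exists>A B C D E.
        (interlock_order p q \<alpha> A B C D E \<or> interlock_order q p \<alpha> A B C D E) \<and>
        \<beta> = entries A @ entries D @ entries C @ entries B @ entries E)"

definition cds_move :: "nat list \<Rightarrow> nat list \<Rightarrow> bool" where
  "cds_move \<alpha> \<beta> \<longleftrightarrow> (\<exists>p q. cds p q \<alpha> \<beta>)"

definition cds_fixed_point :: "nat list \<Rightarrow> bool" where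
  "cds_fixed_point \<alpha> \<longleftrightarrow> \<not> (\<exists>p q. interlock p q \<alpha>)"

definition cds_sortable :: "nat list \<Rightarrow> bool" where
  "cds_sortable \<alpha> \<longleftrightarrow> cds_move\<^sup>*\<^sup>* \<alpha> [1..<Suc (length \<alpha>)]"

definition has_code :: "nat list \<Rightarrow> ptr \<Rightarrow> bool" where
  "has_code \<beta> p \<longleftrightarrow>
     (\<exists>i. 2 \<le> i \<and> i \<le> length \<beta> \<and>
        \<beta> = [i..<Suc (length \<beta>)] @ [1..<i] \<and> p = (i - 1, i))"

definition dotted_edges :: "nat list \<Rightarrow> (nat \<times> nat) set" where
  "dotted_edges \<alpha> = {(i, Suc i) | i. i \<le> length \<alpha>}"

definition black_edges :: "nat list \<Rightarrow> (nat \<times> nat) set" where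
  "black_edges \<alpha> =
     (let a = 0 # \<alpha> @ [Suc (length \<alpha>)]
      in {(a ! k, a ! (k - 1)) | k. 1 \<le> k \<and> k \<le> Suc (length \<alpha>)})"

text \<open>A directed alternating cycle is given by the cyclic sequence of its dotted edges; the
  black edges are the ones leading from the end of each dotted edge to the start of the next.\<close>

definition alternating_cycle :: "nat list \<Rightarrow> (nat \<times> nat) list \<Rightarrow> bool" where
  "alternating_cycle \<alpha> ds \<longleftrightarrow>
     ds \<noteq> [] \<and> distinct ds \<and> set ds \<subseteq> dotted_edges \<alpha> \<and>
     (\<forall>k < length ds.
        (snd (ds ! k), fst (ds ! (Suc k mod length ds))) \<in> black_edges \<alpha>)"

text \<open>Here \<open>xs\<close> lists the dotted edges strictly between \<open>n \<rightarrow> n + 1\<close> and \<open>0 \<rightarrow> 1\<close> on the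
  cycle through both; if there is no such cycle, the set is empty.\<close>

definition strategic_pile :: "nat list \<Rightarrow> ptr set" where
  "strategic_pile \<alpha> =
     {p \<in> pointers \<alpha>. \<exists>xs ys.
        alternating_cycle \<alpha> ([(length \<alpha>, Suc (length \<alpha>))] @ xs @ [(0, 1)] @ ys) \<and>
        p \<in> set xs}"

datatype player = ONE | TWO

text \<open>Plays are recorded as nonempty lists of successive positions; the player to move from
  the position with index \<open>i\<close> is \<open>to_move i\<close>.\<close>

definition to_move :: "nat \<Rightarrow> player" where
  "to_move i = (if even i then ONE else TWO)"

definition play :: "nat list \<Rightarrow> nat list list \<Rightarrow> bool" where
  "play \<alpha> h \<longleftrightarrow>
     h \<noteq> [] \<and> hd h = \<alpha> \<and>
     (\<forall>i. Suc i < length h \<longrightarrow> cds_move (h ! i) (h ! Suc i))"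

text \<open>A strategy chooses a pair of pointers depending on the whole history of the play.\<close>

type_synonym strategy = "nat list list \<Rightarrow> ptr \<times> ptr"

definition follows :: "player \<Rightarrow> strategy \<Rightarrow> nat list list \<Rightarrow> bool" where
  "follows X \<sigma> h \<longleftrightarrow>
     (\<forall>i. Suc i < length h \<and> to_move i = X \<longrightarrow>
        (case \<sigma> (take (Suc i) h) of (p, q) \<Rightarrow> cds p q (h ! i) (h ! Suc i)))"

fun wins :: "player \<Rightarrow> ptr set \<Rightarrow> nat list \<Rightarrow> bool" where
  "wins ONE A \<beta> \<longleftrightarrow> (\<exists>p \<in> A. has_code \<beta> p)"
| "wins TWO A \<beta> \<longleftrightarrow> \<not> (\<exists>p \<in> A. has_code \<beta> p)"

text \<open>A strategy of player \<open>X\<close> is winning if it always prescribes a legal move when \<open>X\<close> has to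
  move, every play following it that has ended is won by \<open>X\<close>, and no play following it goes on
  forever.\<close>

definition winning_strategy :: "player \<Rightarrow> nat list \<Rightarrow> ptr set \<Rightarrow> strategy \<Rightarrow> bool" where
  "winning_strategy X \<alpha> A \<sigma> \<longleftrightarrow>
     (\<forall>h. play \<alpha> h \<and> follows X \<sigma> h \<longrightarrow>
        (if cds_fixed_point (last h) then wins X A (last h)
         else to_move (length h - 1) = X \<longrightarrow>
           (case \<sigma> h of (p, q) \<Rightarrow> interlock p q (last h)))) \<and>
     \<not> (\<exists>f :: nat \<Rightarrow> nat list. \<forall>m.
          play \<alpha> (map f [0..<Suc m]) \<and> follows X \<sigma> (map f [0..<Suc m]))"

definition has_winning_strategy :: "player \<Rightarrow> nat list \<Rightarrow> ptr set \<Rightarrow> bool" where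
  "has_winning_strategy X \<alpha> A \<longleftrightarrow> (\<exists>\<sigma>. winning_strategy X \<alpha> A \<sigma>)"

end

theory Submission imports Defs begin

text \<open>The alternating cycles are the cycles of the permutation \<open>c\<close> of \<open>{0..n}\<close> that sends \<open>k\<close> to the
  left neighbour of \<open>k + 1\<close>, and the strategic pile is what \<open>c\<close> passes on its way from \<open>n\<close> to \<open>0\<close>.
  Applying \<open>cds\<close> to \<open>p\<close> and \<open>q\<close> turns both into fixed points of \<open>c\<close>, short-circuiting the cycles
  through them, so it removes exactly \<open>p\<close> and \<open>q\<close> from the pile. A pointer that interlocks with no
  other one is either an adjacency, and then not in the pile, or it surrounds the whole permutation,
  and then it is the entire pile. Hence each player can remove any chosen element from a pile of at
  least two elements, the pile never becomes empty when starting from a non-sortable permutation,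
  and the game ends in the code that remains. Each player just keeps removing elements that are
  bad for them; counting shows that these run out first.\<close>

section \<open>The cycle permutation and the strategic pile\<close>

text \<open>The entry of \<open>a # xs\<close> preceding \<open>x\<close>. The value \<open>x - 1\<close> for \<open>x\<close> outside \<open>xs\<close> makes the
  map \<open>cyc \<alpha>\<close> below fix every number larger than \<open>length \<alpha>\<close>, hence a permutation of \<^typ>\<open>nat\<close>.\<close>

fun pred_in :: "nat \<Rightarrow> nat list \<Rightarrow> nat \<Rightarrow> nat" where
  "pred_in a [] x = x - 1"
| "pred_in a (y # ys) x = (if x = y then a else pred_in y ys x)"

lemma pred_in_append:
  "pred_in a (xs @ ys) x = (if x \<in> set xs then pred_in a xs x else pred_in (last (a # xs)) ys x)"
  by (induction xs arbitrary: a) auto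

lemma pred_in_notin: "x \<notin> set xs \<Longrightarrow> pred_in a xs x = x - 1"
  by (induction xs arbitrary: a) auto

lemma pred_in_mem: "x \<in> set xs \<Longrightarrow> pred_in a xs x \<in> insert a (set (butlast xs))"
  by (induction xs arbitrary: a) auto

lemma pred_in_nth:
  "distinct xs \<Longrightarrow> k < length xs \<Longrightarrow> pred_in a xs (xs ! k) = (a # xs) ! k"
  by (induction xs arbitrary: a k) (auto simp: nth_Cons split: nat.splits)

section \<open>Deleting one point from an orbit\<close>

definition bypass :: "'a \<Rightarrow> ('a \<Rightarrow> 'a) \<Rightarrow> 'a \<Rightarrow> 'a" where
  "bypass i c k = (if k = i then i else if c k = i then c i else c k)"

text \<open>The walk stops at its first arrival at \<open>t\<close>, which is still included;
  without an arrival the set is the whole forward orbit of \<open>c s\<close>. The inductive form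
  avoids step counts, which \<open>bypass\<close> would shift.\<close>

inductive_set visited :: "('a \<Rightarrow> 'a) \<Rightarrow> 'a \<Rightarrow> 'a \<Rightarrow> 'a set" for c s t where
  start: "c s \<in> visited c s t"
| step: "x \<in> visited c s t \<Longrightarrow> x \<noteq> t \<Longrightarrow> c x \<in> visited c s t"

text \<open>By injectivity a fixed point can only be entered from itself, and the walk starts
  elsewhere.\<close>

lemma fixpoint_notin_visited:
  assumes "inj c" "i \<noteq> s" "c i = i"
  shows "i \<notin> visited c s t"
proof -
  have "x \<noteq> i" if "x \<in> visited c s t" for x
    using that by induction (use assms in \<open>metis injD\<close>)+
  then show ?thesis by blast
qed

text \<open>The walk of \<open>bypass i c\<close> takes the same steps but jumps over
  \<open>i\<close>; as \<open>i\<close> is neither \<open>s\<close> nor \<open>t\<close>, start and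
  stopping point are unaffected.\<close>

lemma visited_bypass:
  assumes "inj c" "i \<noteq> s" "i \<noteq> t"
  shows "visited (bypass i c) s t = visited c s t - {i}"
proof (cases "c i = i")
  case True
  have "bypass i c = c"
    using True by (auto simp: bypass_def)
  then show ?thesis using fixpoint_notin_visited[OF assms(1,2) True] by simp
next
  case False
  have "x \<in> visited c s t \<and> x \<noteq> i" if "x \<in> visited (bypass i c) s t" for x
    using that
  proof induction
    case start
    show ?case
      using assms False visited.start[of c s t] visited.step[of i c s t]
      by (auto simp: bypass_def)
  next
    case (step x)
    then show ?case
      using assms False visited.step[of x c s t] visited.step[of i c s t]
      by (auto simp: bypass_def)
  qed
  \<comment> \<open>While the original walk stands on \<open>i\<close>, the shortened one has
    already jumped to \<open>c i\<close>; the conditional makes the induction go through.\<close>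
  moreover have "(if x = i then c i else x) \<in> visited (bypass i c) s t" if "x \<in> visited c s t" for x
    using that
  proof induction
    case start
    show ?case
      using assms(2) visited.start[of "bypass i c" s t] bypass_def[of i c s] by metis
  next
    case (step x)
    show ?case
    proof (cases "x = i")
      case True
      then show ?thesis using step False by auto
    next
      case F: False
      then have "x \<in> visited (bypass i c) s t" using step by auto
      from visited.step[OF this \<open>x \<noteq> t\<close>] show ?thesis
        using F bypass_def[of i c x] by metis
    qed
  qed
  then have "x \<in> visited (bypass i c) s t" if "x \<in> visited c s t" "x \<noteq> i" for x
    using that by (metis (full_types))
  ultimately show ?thesis by blast
qed

text \<open>The empty value when the walk never meets \<open>t\<close> matches the convention for a
  strategic pile whose two distinguished edges lie on different cycles.\<close>

definition between :: "('a \<Rightarrow> 'a) \<Rightarrow> 'a \<Rightarrow> 'a \<Rightarrow> 'a set" where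
  "between c s t = (if t \<in> visited c s t then visited c s t - {t} else {})"

lemma between_bypass:
  "inj c \<Longrightarrow> i \<noteq> s \<Longrightarrow> i \<noteq> t \<Longrightarrow> between (bypass i c) s t = between c s t - {i}"
  by (auto simp: between_def visited_bypass)

definition perm_list :: "nat list \<Rightarrow> bool" where
  "perm_list \<alpha> \<longleftrightarrow> distinct \<alpha> \<and> set \<alpha> = {1..length \<alpha>}"

text \<open>Following the dotted edge from \<open>k\<close> and then the black edge from \<open>k + 1\<close> leads to the left
  neighbour of \<open>k + 1\<close>; the alternating cycles are the cycles of this permutation.\<close>

definition cyc :: "nat list \<Rightarrow> nat \<Rightarrow> nat" where
  "cyc \<alpha> k = pred_in 0 (\<alpha> @ [Suc (length \<alpha>)]) (Suc k)"

lemma black_edges_iff: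
  assumes "perm_list \<alpha>"
  shows "(x, y) \<in> black_edges \<alpha> \<longleftrightarrow> (\<exists>k \<le> length \<alpha>. x = Suc k \<and> y = cyc \<alpha> k)"
proof -
  let ?b = "\<alpha> @ [Suc (length \<alpha>)]"
  have d: "distinct ?b" and s: "set ?b = {1..Suc (length \<alpha>)}"
    using assms by (auto simp: perm_list_def)
  have "(x, y) \<in> black_edges \<alpha> \<longleftrightarrow> (\<exists>m < length ?b. x = ?b ! m \<and> y = (0 # ?b) ! m)"
  proof
    assume "(x, y) \<in> black_edges \<alpha>"
    then obtain k where k: "1 \<le> k" "k \<le> length ?b" "x = (0 # ?b) ! k" "y = (0 # ?b) ! (k - 1)"
      by (auto simp: black_edges_def Let_def)
    then show "\<exists>m < length ?b. x = ?b ! m \<and> y = (0 # ?b) ! m"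
      by (intro exI[of _ "k - 1"]) (auto simp: nth_Cons')
  next
    assume "\<exists>m < length ?b. x = ?b ! m \<and> y = (0 # ?b) ! m"
    then obtain m where m: "m < length ?b" "x = ?b ! m" "y = (0 # ?b) ! m" by blast
    then have "1 \<le> Suc m \<and> Suc m \<le> Suc (length \<alpha>) \<and>
        (x, y) = ((0 # ?b) ! Suc m, (0 # ?b) ! (Suc m - 1))" by simp
    then show "(x, y) \<in> black_edges \<alpha>"
      unfolding black_edges_def Let_def by blast
  qed
  also have "\<dots> \<longleftrightarrow> (\<exists>m < length ?b. x = ?b ! m \<and> y = pred_in 0 ?b x)"
    using pred_in_nth[OF d, of _ 0] by auto
  also have "\<dots> \<longleftrightarrow> x \<in> set ?b \<and> y = pred_in 0 ?b x"
    by (auto simp only: in_set_conv_nth)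
  also have "\<dots> \<longleftrightarrow> (\<exists>k \<le> length \<alpha>. x = Suc k \<and> y = cyc \<alpha> k)"
    unfolding s cyc_def by (cases x) auto
  finally show ?thesis .
qed

lemma cyc_permutes:
  assumes "perm_list \<alpha>"
  shows "cyc \<alpha> permutes {..length \<alpha>}"
proof (rule bij_imp_permutes)
  let ?b = "\<alpha> @ [Suc (length \<alpha>)]"
  have d: "distinct ?b" and s: "set ?b = {1..Suc (length \<alpha>)}"
    using assms by (auto simp: perm_list_def)
  have d0: "distinct (0 # ?b)" using d s by auto
  have inj: "inj_on (cyc \<alpha>) {..length \<alpha>}"
  proof (rule inj_onI)
    fix k l assume *: "k \<in> {..length \<alpha>}" "l \<in> {..length \<alpha>}" "cyc \<alpha> k = cyc \<alpha> l"
    have "Suc k \<in> set ?b" "Suc l \<in> set ?b" using * unfolding s by auto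
    then obtain u v where uv: "u < length ?b" "?b ! u = Suc k" "v < length ?b" "?b ! v = Suc l"
      by (metis in_set_conv_nth)
    have "(0 # ?b) ! u = (0 # ?b) ! v"
      using pred_in_nth[OF d, of u 0] pred_in_nth[OF d, of v 0] uv *(3) by (simp add: cyc_def)
    then have "u = v"
      using nth_eq_iff_index_eq[OF d0, of u v] uv by auto
    then show "k = l" using uv by simp
  qed
  moreover have "cyc \<alpha> ` {..length \<alpha>} \<subseteq> {..length \<alpha>}"
  proof
    fix y assume "y \<in> cyc \<alpha> ` {..length \<alpha>}"
    then obtain k where k: "k \<le> length \<alpha>" "y = cyc \<alpha> k" by auto
    have "Suc k \<in> set ?b" using k unfolding s by auto
    from pred_in_mem[OF this, of 0] show "y \<in> {..length \<alpha>}"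
      using k assms by (auto simp: cyc_def perm_list_def)
  qed
  ultimately show "bij_betw (cyc \<alpha>) {..length \<alpha>} {..length \<alpha>}"
    by (simp add: bij_betw_def endo_inj_surj)
next
  fix k assume "k \<notin> {..length \<alpha>}"
  then have "Suc k \<notin> set (\<alpha> @ [Suc (length \<alpha>)])"
    using assms by (simp add: perm_list_def)
  then show "cyc \<alpha> k = k"
    unfolding cyc_def by (metis diff_Suc_1 pred_in_notin)
qed

lemma visited_funpow:
  assumes "(c ^^ a) s = t" "0 < a" "\<And>k. 0 < k \<Longrightarrow> k < a \<Longrightarrow> (c ^^ k) s \<noteq> t"
  shows "visited c s t = (\<lambda>k. (c ^^ k) s) ` {1..a}"
proof (intro equalityI subsetI)
  fix x assume "x \<in> visited c s t"
  then show "x \<in> (\<lambda>k. (c ^^ k) s) ` {1..a}"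
  proof induction
    case start
    have "c s = (c ^^ 1) s" by simp
    then show ?case using assms(2) by (intro image_eqI[of _ _ 1]) auto
  next
    case (step x)
    then obtain k where k: "1 \<le> k" "k \<le> a" "x = (c ^^ k) s" by auto
    then have "k < a" using step assms(1) by (cases "k = a") auto
    then show ?case using k by (intro image_eqI[of _ _ "Suc k"]) auto
  qed
next
  have *: "(c ^^ Suc k) s \<in> visited c s t" if "Suc k \<le> a" for k
    using that
  proof (induction k)
    case 0
    then show ?case by (simp add: visited.start)
  next
    case (Suc k)
    then show ?case using assms(3)[of "Suc k"] visited.step[of "(c ^^ Suc k) s" c s t] by simp
  qed
  fix x assume "x \<in> (\<lambda>k. (c ^^ k) s) ` {1..a}"
  then obtain k where "1 \<le> k" "k \<le> a" "x = (c ^^ k) s" by auto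
  then show "x \<in> visited c s t" using *[of "k - 1"] by simp
qed

lemma visited_imp_funpow: "x \<in> visited c s t \<Longrightarrow> \<exists>k. x = (c ^^ k) s"
proof (induction rule: visited.induct)
  case start
  then show ?case by (intro exI[of _ 1]) auto
next
  case (step x)
  then obtain k where "x = (c ^^ k) s" by auto
  then show ?case by (intro exI[of _ "Suc k"]) auto
qed

text \<open>Along an alternating cycle, the starting points of successive dotted edges are
  successive values of \<open>cyc \<alpha>\<close>. Conversely, the orbit of
  \<open>length \<alpha>\<close>, listed from that point on, is the required cycle.\<close>

lemma strategic_pile_eq:
  assumes perm: "perm_list \<alpha>" and ne: "\<alpha> \<noteq> []"
  shows "strategic_pile \<alpha> = (\<lambda>i. (i, Suc i)) ` between (cyc \<alpha>) (length \<alpha>) 0"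
proof (intro equalityI subsetI)
  let ?n = "length \<alpha>" and ?c = "cyc \<alpha>"
  fix p assume "p \<in> strategic_pile \<alpha>"
  then obtain xs ys where cyc: "alternating_cycle \<alpha> ([(?n, Suc ?n)] @ xs @ [(0, 1)] @ ys)"
    and p: "p \<in> pointers \<alpha>" "p \<in> set xs"
    unfolding strategic_pile_def by blast
  let ?d = "[(?n, Suc ?n)] @ xs @ [(0, 1)] @ ys"
  have dist: "distinct ?d" and sub: "set ?d \<subseteq> dotted_edges \<alpha>"
    and edge: "\<And>k. k < length ?d \<Longrightarrow> (snd (?d ! k), fst (?d ! (Suc k mod length ?d))) \<in> black_edges \<alpha>"
    using cyc unfolding alternating_cycle_def by blast+
  have dotted: "?d ! k \<in> dotted_edges \<alpha>" if "k < length ?d" for k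
    using sub nth_mem[OF that] by blast
  have next_eq: "fst (?d ! Suc k) = ?c (fst (?d ! k))" if "Suc k < length ?d" for k
    using edge[of k] dotted[of k] that
    unfolding black_edges_iff[OF perm] dotted_edges_def mod_less[OF that] by auto
  \<comment> \<open>Distinctness keeps \<open>(0, 1)\<close> out of \<open>xs\<close>, and no other
    dotted edge starts at 0, so the walk does not stop within \<open>xs\<close>.\<close>
  have visit: "fst (?d ! Suc k) \<in> visited ?c ?n 0" if "k \<le> length xs" for k
    using that
  proof (induction k)
    case 0
    then show ?case using next_eq[of 0] by (simp add: visited.start)
  next
    case (Suc k)
    have "?d ! Suc k \<in> set xs" using Suc.prems by (simp add: nth_append)
    then have "?d ! Suc k \<noteq> (0, 1)" using dist by auto
    then have "fst (?d ! Suc k) \<noteq> 0"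
      using dotted[of "Suc k"] Suc.prems by (auto simp: dotted_edges_def)
    with Suc visited.step[of "fst (?d ! Suc k)" ?c ?n 0] next_eq[of "Suc k"] show ?case by simp
  qed
  have "0 \<in> visited ?c ?n 0" using visit[of "length xs"] by simp
  moreover from p(2) obtain k where "k < length xs" "xs ! k = p" by (auto simp: in_set_conv_nth)
  then have "fst p \<in> visited ?c ?n 0" using visit[of k] by (simp add: nth_append)
  ultimately show "p \<in> (\<lambda>i. (i, Suc i)) ` between ?c ?n 0"
    using p(1) by (force simp: between_def pointers_def)
next
  let ?n = "length \<alpha>" and ?c = "cyc \<alpha>"
  fix p assume "p \<in> (\<lambda>i. (i, Suc i)) ` between ?c ?n 0"
  then obtain i where p: "p = (i, Suc i)" and i: "i \<in> visited ?c ?n 0" "i \<noteq> 0"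
    and zero: "0 \<in> visited ?c ?n 0"
    by (auto simp: between_def split: if_splits)
  \<comment> \<open>\<open>m\<close> is the length of the cycle through \<open>?n\<close>; the first
    \<open>m\<close> iterates are distinct and supply the dotted edges.\<close>
  define m where "m = least_power ?c ?n"
  have permutes: "?c permutes {..?n}" by (rule cyc_permutes[OF perm])
  then have permn: "permutation ?c" using permutation_permutes by blast
  have m: "(?c ^^ m) ?n = ?n" "0 < m"
    using least_power_of_permutation[OF permn, of ?n] by (auto simp: m_def)
  have dist: "distinct (support ?c ?n)" using cycle_of_permutation[OF permn] .
  have bound: "(?c ^^ k) ?n \<le> ?n" for k
  proof (induction k)
    case (Suc k)
    then show ?case using permutes_in_image[OF permutes, of "(?c ^^ k) ?n"] by simp
  qed simp
  obtain k where "k < m" "(?c ^^ k) ?n = 0"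
  proof -
    from visited_imp_funpow[OF zero] have "0 \<in> set (support ?c ?n)"
      unfolding support_set[OF permn] by auto
    then show ?thesis using that by (auto simp: m_def)
  qed
  \<comment> \<open>The first arrival at 0 cuts the list of iterates into the pile part and the rest
    of the cycle.\<close>
  define a where "a = (LEAST k. (?c ^^ k) ?n = 0)"
  have a0: "(?c ^^ a) ?n = 0" unfolding a_def by (rule LeastI) fact
  have "a \<le> k" unfolding a_def by (rule Least_le) fact
  then have "a < m" using \<open>k < m\<close> by simp
  have "a \<noteq> 0" using a0 ne by (metis funpow_0 length_0_conv)
  have vis: "visited ?c ?n 0 = (\<lambda>k. (?c ^^ k) ?n) ` {1..a}"
    by (rule visited_funpow) (use a0 \<open>a \<noteq> 0\<close> not_less_Least[of _ "\<lambda>k. (?c ^^ k) ?n = 0"] in \<open>auto simp: a_def\<close>)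
  let ?g = "\<lambda>k. ((?c ^^ k) ?n, Suc ((?c ^^ k) ?n))"
  let ?d = "map ?g [0..<m]"
  have split: "[0..<m] = [0] @ [1..<a] @ [a] @ [Suc a..<m]"
  proof -
    have "[0..<m] = [0..<a] @ [a..<m]" using \<open>a < m\<close> upt_add_eq_append[of 0 a "m - a"] by simp
    moreover have "[0..<a] = 0 # [1..<a]" using \<open>a \<noteq> 0\<close> upt_conv_Cons[of 0 a] by simp
    ultimately show ?thesis using \<open>a < m\<close> by (simp add: upt_conv_Cons)
  qed
  have "alternating_cycle \<alpha> ?d"
    unfolding alternating_cycle_def
  proof (intro conjI allI impI)
    show "?d \<noteq> []" using m by simp
    show "distinct ?d" using dist by (auto simp: distinct_map inj_on_def m_def)
    show "set ?d \<subseteq> dotted_edges \<alpha>" using bound by (auto simp: dotted_edges_def)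
  next
    fix k assume k: "k < length ?d"
    have "fst (?d ! (Suc k mod length ?d)) = ?c ((?c ^^ k) ?n)"
    proof (cases "Suc k = m")
      case True
      then have "?c ((?c ^^ k) ?n) = ?n" using m(1) by auto
      then show ?thesis using True m(2) by simp
    next
      case False
      then show ?thesis using k by simp
    qed
    then show "(snd (?d ! k), fst (?d ! (Suc k mod length ?d))) \<in> black_edges \<alpha>"
      using k bound[of k] unfolding black_edges_iff[OF perm] by simp
  qed
  moreover have "?d = [(?n, Suc ?n)] @ map ?g [1..<a] @ [(0, 1)] @ map ?g [Suc a..<m]"
    unfolding split using a0 by simp
  moreover obtain l where l: "1 \<le> l" "l \<le> a" "i = (?c ^^ l) ?n" using i vis by auto
  then have "l < a" using a0 i(2) by (cases "l = a") auto
  then have "p \<in> set (map ?g [1..<a])" using l p by auto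
  \<comment> \<open>\<open>?n\<close> occupies index 0 among the distinct iterates; excluding it
    puts \<open>i\<close> strictly below \<open>?n\<close>, as a pointer requires.\<close>
  moreover have "i \<noteq> ?n"
    using nth_eq_iff_index_eq[OF dist, of l 0] l \<open>l < a\<close> \<open>a < m\<close> by (auto simp: m_def)
  then have "p \<in> pointers \<alpha>" using p i bound[of l] l by (auto simp: pointers_def)
  ultimately show "p \<in> strategic_pile \<alpha>"
    unfolding strategic_pile_def by (intro CollectI conjI exI) auto
qed

section \<open>The effect of \<open>cds\<close> on the cycle permutation\<close>

text \<open>Consecutive blocks \<open>A B C D\<close> of entries such that the two occurrences of the pointer
  \<open>(i, i + 1)\<close> lie in the gaps \<open>A | B\<close> and \<open>C | D\<close>. Recording which of the two is the head
  pointer also settles the cases in which blocks are empty and gaps coincide.\<close>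

definition cut_at :: "nat \<Rightarrow> nat list \<Rightarrow> nat list \<Rightarrow> nat list \<Rightarrow> nat list \<Rightarrow> bool" where
  "cut_at i A B C D \<longleftrightarrow>
     A \<noteq> [] \<and> last A = i \<and> D \<noteq> [] \<and> hd D = Suc i \<or>
     B \<noteq> [] \<and> hd B = Suc i \<and> C \<noteq> [] \<and> last C = i"

text \<open>Moving whole blocks can affect only the predecessors of block heads, because all other
  predecessors lie inside the block.\<close>

lemma pred_in_tl:
  assumes "x \<in> set xs" "x \<noteq> hd xs"
  shows "pred_in a xs x = pred_in b xs x" "pred_in a xs x \<in> set (butlast xs)"
proof -
  obtain y ys where xs: "xs = y # ys" using assms by (cases xs) auto
  show "pred_in a xs x = pred_in b xs x" using assms xs by simp
  show "pred_in a xs x \<in> set (butlast xs)"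
    using assms pred_in_mem[of x ys y] by (auto simp: xs)
qed

lemma last_notin_butlast: "distinct xs \<Longrightarrow> last xs \<notin> set (butlast xs)"
  by (cases xs rule: rev_cases) auto

lemma last_neq: "distinct (xs @ ys) \<Longrightarrow> xs \<noteq> [] \<Longrightarrow> ys \<noteq> [] \<Longrightarrow> last xs \<noteq> last ys"
  by (metis disjoint_iff distinct_append last_in_set)

lemma hd_neq: "distinct (xs @ ys) \<Longrightarrow> xs \<noteq> [] \<Longrightarrow> ys \<noteq> [] \<Longrightarrow> hd xs \<noteq> hd ys"
  by (metis disjoint_iff distinct_append hd_in_set)

text \<open>The new gaps are A|D, D|C, C|B and B|E. The cut of \<open>i\<close> turns A|D or C|B
  into an adjacency of \<open>i\<close> and \<open>i + 1\<close>, and the cut of \<open>j\<close>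
  does the same for D|C or B|E. The other block heads get the predecessor found by skipping
  \<open>i\<close> and \<open>j\<close>.\<close>

lemma pred_in_interchange:
  assumes dist: "distinct (z # A @ B @ C @ D @ E)"
    and i: "cut_at i (z # A) B C D" and j: "cut_at j B C D E" and "i \<noteq> j"
  shows "pred_in z (A @ D @ C @ B @ E) (Suc k) =
    bypass j (bypass i (\<lambda>k. pred_in z (A @ B @ C @ D @ E) (Suc k))) k"
proof -
  define F where "F = pred_in z (A @ B @ C @ D @ E)"
  define G where "G = pred_in z (A @ D @ C @ B @ E)"
  define l where "l = last (z # A)"
  \<comment> \<open>The last entry of \<open>X\<close>, or, if \<open>X\<close> is empty, the entry
    \<open>d\<close> that precedes it.\<close>
  let ?L = "\<lambda>X d. if X = [] then d else last X"
  have F: "B \<noteq> [] \<Longrightarrow> F (hd B) = l"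
    "C \<noteq> [] \<Longrightarrow> F (hd C) = ?L B l"
    "D \<noteq> [] \<Longrightarrow> F (hd D) = ?L C (?L B l)"
    "E \<noteq> [] \<Longrightarrow> F (hd E) = ?L D (?L C (?L B l))"
    subgoal using dist by (cases B) (auto simp: F_def l_def pred_in_append)
    subgoal using dist by (cases C) (auto simp: F_def l_def pred_in_append)
    subgoal using dist by (cases D) (auto simp: F_def l_def pred_in_append)
    subgoal using dist by (cases E) (auto simp: F_def l_def pred_in_append)
    done
  have G: "D \<noteq> [] \<Longrightarrow> G (hd D) = l"
    "C \<noteq> [] \<Longrightarrow> G (hd C) = ?L D l"
    "B \<noteq> [] \<Longrightarrow> G (hd B) = ?L C (?L D l)"
    "E \<noteq> [] \<Longrightarrow> G (hd E) = ?L B (?L C (?L D l))"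
    subgoal using dist by (cases D) (auto simp: G_def l_def pred_in_append)
    subgoal using dist by (cases C) (auto simp: G_def l_def pred_in_append)
    subgoal using dist by (cases B) (auto simp: G_def l_def pred_in_append)
    subgoal using dist by (cases E) (auto simp: G_def l_def pred_in_append)
    done
  have l: "l \<in> set (z # A)" unfolding l_def by (rule last_in_set) simp
  have last: "B \<noteq> [] \<Longrightarrow> last B \<in> set B" "C \<noteq> [] \<Longrightarrow> last C \<in> set C"
    "D \<noteq> [] \<Longrightarrow> last D \<in> set D" by simp_all
  have ne: "B \<noteq> [] \<Longrightarrow> last B \<noteq> l" "C \<noteq> [] \<Longrightarrow> last C \<noteq> l" "D \<noteq> [] \<Longrightarrow> last D \<noteq> l"
    "B \<noteq> [] \<Longrightarrow> C \<noteq> [] \<Longrightarrow> last B \<noteq> last C" "B \<noteq> [] \<Longrightarrow> D \<noteq> [] \<Longrightarrow> last B \<noteq> last D"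
    "C \<noteq> [] \<Longrightarrow> D \<noteq> [] \<Longrightarrow> last C \<noteq> last D"
    subgoal using dist l last(1) by auto
    subgoal using dist l last(2) by auto
    subgoal using dist l last(3) by auto
    subgoal using dist last_neq[of B C] by auto
    subgoal using dist last_neq[of B D] by auto
    subgoal using dist last_neq[of C D] by auto
    done
  have i': "D \<noteq> [] \<and> i = l \<and> Suc i = hd D \<or> B \<noteq> [] \<and> C \<noteq> [] \<and> i = last C \<and> Suc i = hd B"
    using i unfolding cut_at_def l_def by (elim disjE conjE) simp_all
  have j': "B \<noteq> [] \<and> E \<noteq> [] \<and> j = last B \<and> Suc j = hd E \<or>
      C \<noteq> [] \<and> D \<noteq> [] \<and> j = last D \<and> Suc j = hd C"
    using j unfolding cut_at_def by (elim disjE conjE) simp_all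
  have hne: "B \<noteq> [] \<Longrightarrow> C \<noteq> [] \<Longrightarrow> hd B \<noteq> hd C" "B \<noteq> [] \<Longrightarrow> D \<noteq> [] \<Longrightarrow> hd B \<noteq> hd D"
    "B \<noteq> [] \<Longrightarrow> E \<noteq> [] \<Longrightarrow> hd B \<noteq> hd E" "C \<noteq> [] \<Longrightarrow> D \<noteq> [] \<Longrightarrow> hd C \<noteq> hd D"
    "C \<noteq> [] \<Longrightarrow> E \<noteq> [] \<Longrightarrow> hd C \<noteq> hd E" "D \<noteq> [] \<Longrightarrow> E \<noteq> [] \<Longrightarrow> hd D \<noteq> hd E"
    using dist hd_neq[of B C] hd_neq[of B D] hd_neq[of B E] hd_neq[of C D] hd_neq[of C E]
      hd_neq[of D E] by auto
  \<comment> \<open>Generalising \<open>Suc i\<close>, \<open>Suc j\<close>, \<open>Suc k\<close> to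
    arbitrary \<open>i'\<close>, \<open>j'\<close>, \<open>x\<close> leaves a finite check: which
    option of each cut, which head, which blocks are empty.\<close>
  have heads_eq: "G x = (let f = (\<lambda>x. if x = i' then i else if F x = i then F i' else F x)
      in if x = j' then j else if f x = j then f j' else f x)"
    if "D \<noteq> [] \<and> i = l \<and> i' = hd D \<or> B \<noteq> [] \<and> C \<noteq> [] \<and> i = last C \<and> i' = hd B"
      "B \<noteq> [] \<and> E \<noteq> [] \<and> j = last B \<and> j' = hd E \<or> C \<noteq> [] \<and> D \<noteq> [] \<and> j = last D \<and> j' = hd C"
      "B \<noteq> [] \<and> x = hd B \<or> C \<noteq> [] \<and> x = hd C \<or> D \<noteq> [] \<and> x = hd D \<or> E \<noteq> [] \<and> x = hd E"
    for x i' j'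
    using that \<open>i \<noteq> j\<close> unfolding Let_def
    by (elim disjE conjE; cases "B = []"; cases "C = []"; cases "D = []"; cases "E = []")
      (simp_all add: F G ne ne[symmetric] hne hne[symmetric])
  have bypass_eq: "bypass j (bypass i (\<lambda>k. F (Suc k))) k =
      (let f = (\<lambda>x. if x = Suc i then i else if F x = i then F (Suc i) else F x)
       in if Suc k = Suc j then j else if f (Suc k) = j then f (Suc j) else f (Suc k))"
    by (simp add: bypass_def Let_def)
  \<comment> \<open>\<open>bypass\<close> acts only where the argument or the value is the deleted
    point; this settles every \<open>k\<close> for which \<open>Suc k\<close> is not the head of
    \<open>B\<close>, \<open>C\<close>, \<open>D\<close> or \<open>E\<close>.\<close>
  have interior: "G (Suc k) = bypass j (bypass i (\<lambda>k. F (Suc k))) k"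
    if "G (Suc k) = F (Suc k)" "k \<noteq> i" "k \<noteq> j" "F (Suc k) \<noteq> i" "F (Suc k) \<noteq> j"
    using that by (simp add: bypass_def)
  have heads: "Suc i \<in> set B \<and> Suc i = hd B \<or> Suc i \<in> set D \<and> Suc i = hd D"
    "Suc j \<in> set C \<and> Suc j = hd C \<or> Suc j \<in> set E \<and> Suc j = hd E"
    subgoal using i' hd_in_set[of B] hd_in_set[of D] by argo
    subgoal using j' hd_in_set[of C] hd_in_set[of E] by argo
    done
  have lasts: "i = l \<or> i \<in> set C \<and> i = last C" "j \<in> set B \<and> j = last B \<or> j \<in> set D \<and> j = last D"
    subgoal using i' last(2) by argo
    subgoal using j' last(1,3) by argo
    done
  have "G (Suc k) = bypass j (bypass i (\<lambda>k. F (Suc k))) k"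
  proof -
    consider "Suc k \<in> set A" | "Suc k \<notin> set (A @ B @ C @ D @ E)"
      | X where "X \<in> {B, C, D, E}" "Suc k \<in> set X" by auto
    then show ?thesis
    proof cases
      case 1
      have FG: "F (Suc k) = pred_in z A (Suc k)" "G (Suc k) = F (Suc k)"
        using 1 by (simp_all add: F_def G_def pred_in_append)
      have "A \<noteq> []" using 1 by auto
      have "F (Suc k) \<in> insert z (set (butlast A))" unfolding FG using pred_in_mem[OF 1] .
      then have F': "F (Suc k) \<in> set (butlast (z # A))" using \<open>A \<noteq> []\<close> by simp
      have "F (Suc k) \<noteq> l"
        using last_notin_butlast[of "z # A"] dist F' unfolding l_def by auto
      moreover have "F (Suc k) \<in> set (z # A)" using F' by (rule in_set_butlastD)
      ultimately show ?thesis
        using FG(2) 1 dist heads lasts by (intro interior) auto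
    next
      case 2
      have "F (Suc k) = k" using 2 unfolding F_def by (metis diff_Suc_1 pred_in_notin)
      moreover have "G (Suc k) = k"
        using 2 pred_in_notin[of "Suc k" "A @ D @ C @ B @ E" z] by (simp add: G_def)
      moreover have "k \<noteq> i" "k \<noteq> j" using 2 heads by auto
      ultimately show ?thesis by (intro interior) auto
    next
      case X: (3 X)
      show ?thesis
      proof (cases "Suc k = hd X")
        case True
        then have "B \<noteq> [] \<and> Suc k = hd B \<or> C \<noteq> [] \<and> Suc k = hd C \<or>
            D \<noteq> [] \<and> Suc k = hd D \<or> E \<noteq> [] \<and> Suc k = hd E"
          using X by auto
        with i' j' show ?thesis unfolding bypass_eq by (rule heads_eq)
      next
      case 3: False
      have FG: "F (Suc k) = pred_in z X (Suc k) \<and> G (Suc k) = pred_in z X (Suc k)"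
        using 3 X dist pred_in_tl(1)[OF X(2) 3, of _ z]
        by (auto simp: F_def G_def pred_in_append)
      have F': "F (Suc k) \<in> set (butlast X)" using FG pred_in_tl(2)[OF X(2) 3, of z] by simp
      have "distinct X" using X(1) dist by auto
      then have "F (Suc k) \<noteq> last X" using F' last_notin_butlast by metis
      moreover have "F (Suc k) \<in> set X" using F' by (rule in_set_butlastD)
      moreover have "Suc k \<noteq> Suc i" "Suc k \<noteq> Suc j" using 3 X dist heads by auto
      ultimately show ?thesis
        using FG X(1) dist lasts l by (intro interior) auto
      qed
    qed
  qed
  then show ?thesis by (simp add: F_def G_def)
qed

section \<open>From marked lists to cuts\<close>

lemma marked_Nil [simp]: "marked [] = []"
  and marked_Cons [simp]:
    "marked (k # \<alpha>) = Ptr (k - 1, k) # Entry k # Ptr (k, Suc k) # marked \<alpha>"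
  and marked_append [simp]: "marked (\<alpha> @ \<beta>) = marked \<alpha> @ marked \<beta>"
  by (simp_all add: marked_def)

lemma entries_append [simp]: "entries (X @ Y) = entries X @ entries Y"
  by (induction X rule: entries.induct) auto

lemma entries_marked [simp]: "entries (marked \<alpha>) = \<alpha>"
  by (induction \<alpha>) auto

lemma head_in_marked: "k \<in> set \<alpha> \<Longrightarrow> Ptr (k, Suc k) \<in> set (marked \<alpha>)"
  and tail_in_marked: "Suc k \<in> set \<alpha> \<Longrightarrow> Ptr (k, Suc k) \<in> set (marked \<alpha>)"
  by (induction \<alpha>) auto

text \<open>The entry next to an occurrence tells whether it is a head or a tail pointer. The
  induction peels off the three items belonging to one entry.\<close>

lemma marked_occurrence:
  assumes "marked \<alpha> = X @ Ptr p # Y"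
  shows "(\<exists>X'. X = X' @ [Entry (fst p)]) \<or> (\<exists>Y'. Y = Entry (snd p) # Y')"
  using assms
proof (induction \<alpha> arbitrary: X)
  case (Cons k \<alpha>)
  consider "X = []" | x where "X = [x]" | x y where "X = [x, y]" | x y z X' where "X = x # y # z # X'"
    by (metis list.exhaust)
  then show ?case
  proof cases
    case 4
    then show ?thesis using Cons by auto
  qed (use Cons.prems in auto)
qed simp

text \<open>The conditions on \<open>X\<close> and \<open>Y\<close> ensure that an entry next to an
  outer border of the cut belongs to \<open>A\<close> or \<open>D\<close>. Distinctness excludes
  that both occurrences are heads or both are tails.\<close>

lemma cut_at_if_marked:
  assumes "distinct \<alpha>"
    and "marked \<alpha> = X @ A @ [Ptr (i, Suc i)] @ B @ [Ptr q] @ C @ [Ptr (i, Suc i)] @ D @ Y"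
    and "X = [] \<or> (\<exists>r X'. X = X' @ [Ptr r])" and "Y = [] \<or> (\<exists>r Y'. Y = Ptr r # Y')"
  shows "cut_at i (entries A) (entries B) (entries C) (entries D)"
proof -
  have \<alpha>: "\<alpha> = entries X @ entries A @ entries B @ entries C @ entries D @ entries Y"
    using arg_cong[OF assms(2), of entries] by simp
  have 1: "(\<exists>A'. A = A' @ [Entry i]) \<or> (\<exists>B'. B = Entry (Suc i) # B')"
    using marked_occurrence[of \<alpha> "X @ A" "(i, Suc i)"] assms(2,3)
    by (cases A rule: rev_cases; cases B) auto
  have 2: "(\<exists>C'. C = C' @ [Entry i]) \<or> (\<exists>D'. D = Entry (Suc i) # D')"
    using marked_occurrence[of \<alpha> "X @ A @ [Ptr (i, Suc i)] @ B @ [Ptr q] @ C" "(i, Suc i)" "D @ Y"]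
      assms(2,4) by (cases C rule: rev_cases; cases D) auto
  show ?thesis
    using 1 2 assms(1) \<alpha> by (auto simp: cut_at_def)
qed

lemma interlock_order_cut_at:
  assumes "perm_list \<alpha>" and "interlock_order p q \<alpha> A B C D E"
  obtains i j where "p = (i, Suc i)" "q = (j, Suc j)" "i \<noteq> j" "0 < i" "i < length \<alpha>" "0 < j" "j < length \<alpha>"
    "\<alpha> = entries A @ entries B @ entries C @ entries D @ entries E"
    "cut_at i (entries A) (entries B) (entries C) (entries D)"
    "cut_at j (entries B) (entries C) (entries D) (entries E)"
proof -
  have *: "p \<in> pointers \<alpha>" "q \<in> pointers \<alpha>" "p \<noteq> q"
    "marked \<alpha> = A @ [Ptr p] @ B @ [Ptr q] @ C @ [Ptr p] @ D @ [Ptr q] @ E"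
    using assms(2) by (auto simp: interlock_order_def)
  obtain i j where p: "p = (i, Suc i)" "0 < i" "i < length \<alpha>" and q: "q = (j, Suc j)" "0 < j" "j < length \<alpha>"
    using *(1,2) by (auto simp: pointers_def)
  have d: "distinct \<alpha>" using assms(1) by (simp add: perm_list_def)
  have \<alpha>: "\<alpha> = entries A @ entries B @ entries C @ entries D @ entries E"
    using arg_cong[OF *(4), of entries] by simp
  have "cut_at i (entries A) (entries B) (entries C) (entries D)"
    by (rule cut_at_if_marked[OF d, of "[]" _ _ _ q _ _ "Ptr q # E"]) (use * p in auto)
  moreover have "cut_at j (entries B) (entries C) (entries D) (entries E)"
    by (rule cut_at_if_marked[OF d, of "A @ [Ptr p]" _ _ _ p _ _ "[]"]) (use * q in auto)
  ultimately show ?thesis using that p q *(3) \<alpha> by blast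
qed

lemma perm_list_mset_cong: "perm_list \<alpha> \<Longrightarrow> mset \<alpha> = mset \<beta> \<Longrightarrow> perm_list \<beta>"
  unfolding perm_list_def by (metis mset_eq_imp_distinct_iff mset_eq_setD size_mset)

lemma perm_list_sentinels: "perm_list \<alpha> \<Longrightarrow> distinct (0 # \<alpha> @ [Suc (length \<alpha>)])"
  by (simp add: perm_list_def)

lemma inj_bypass: "inj c \<Longrightarrow> inj (bypass i c)"
  unfolding bypass_def by (rule injI) (metis injD)

text \<open>The interlocking pointer of \<open>j\<close> forces \<open>B\<close> or \<open>C\<close>
  to be nonempty, so \<open>i\<close> and \<open>i + 1\<close> cannot be adjacent in this order.
  This makes the termination measure drop strictly.\<close>

lemma cut_at_cyc_neq:
  assumes perm: "perm_list (A @ B @ C @ D @ E)" and i: "cut_at i A B C D" and j: "cut_at j B C D E" and "0 < i"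
  shows "cyc (A @ B @ C @ D @ E) i \<noteq> i"
proof -
  have dist: "distinct (A @ B @ C @ D @ E)" using perm by (simp add: perm_list_def)
  have BC: "B @ C \<noteq> []" using j by (auto simp: cut_at_def)
  from i consider D' where "A \<noteq> []" "last A = i" "D = Suc i # D'" | B' where "B = Suc i # B'" "C \<noteq> []" "last C = i"
    unfolding cut_at_def by (metis list.collapse)
  then show ?thesis
  proof cases
    case 1
    have "cyc (A @ B @ C @ D @ E) i = last (0 # A @ B @ C)"
      using 1 dist by (auto simp: cyc_def pred_in_append)
    also have "\<dots> = last (B @ C)" using BC by (cases "C = []") auto
    also have "distinct (A @ (B @ C))" using dist by auto
    then have "last (B @ C) \<noteq> last A" using last_neq[OF _ 1(1) BC] by metis
    finally show ?thesis using 1 by simp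
  next
    case 2
    have "cyc (A @ B @ C @ D @ E) i = last (0 # A)"
      using 2 dist by (auto simp: cyc_def pred_in_append)
    moreover have "last (0 # A) \<noteq> last C"
      using 2 \<open>0 < i\<close> last_neq[of A C] dist by auto
    ultimately show ?thesis using 2 by simp
  qed
qed

text \<open>The sentinels 0 and \<open>n + 1\<close> are absorbed into the outer blocks
  \<open>A\<close> and \<open>E\<close>, which the operation leaves in place.\<close>

lemma cut_at_cyc_interchange:
  assumes perm: "perm_list (A @ B @ C @ D @ E)" and i: "cut_at i A B C D" and j: "cut_at j B C D E" and "i \<noteq> j"
  shows "cyc (A @ D @ C @ B @ E) = bypass j (bypass i (cyc (A @ B @ C @ D @ E)))"
proof
  fix k
  let ?n = "length (A @ B @ C @ D @ E)"
  have n: "length (A @ D @ C @ B @ E) = ?n" by simp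
  have dist: "distinct (0 # A @ B @ C @ D @ (E @ [Suc ?n]))"
    using perm_list_sentinels[OF perm] by simp
  have "cut_at i (0 # A) B C D" "cut_at j B C D (E @ [Suc ?n])"
    using i j by (auto simp: cut_at_def)
  from pred_in_interchange[OF dist this \<open>i \<noteq> j\<close>, of k]
  show "cyc (A @ D @ C @ B @ E) k = bypass j (bypass i (cyc (A @ B @ C @ D @ E))) k"
    unfolding cyc_def n by (simp add: cyc_def[abs_def])
qed

lemma interlock_order_step:
  assumes "perm_list \<alpha>" and "interlock_order p q \<alpha> A B C D E"
    and \<beta>: "\<beta> = entries A @ entries D @ entries C @ entries B @ entries E"
  obtains i j where "p = (i, Suc i)" "q = (j, Suc j)" "i \<noteq> j" "0 < i" "i < length \<alpha>" "0 < j" "j < length \<alpha>"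
    "perm_list \<beta>" "length \<beta> = length \<alpha>" "cyc \<alpha> i \<noteq> i"
    "cyc \<beta> = bypass j (bypass i (cyc \<alpha>))"
proof -
  obtain i j where ij: "p = (i, Suc i)" "q = (j, Suc j)" "i \<noteq> j" "0 < i" "i < length \<alpha>" "0 < j" "j < length \<alpha>"
    and \<alpha>: "\<alpha> = entries A @ entries B @ entries C @ entries D @ entries E"
    and cut: "cut_at i (entries A) (entries B) (entries C) (entries D)"
    "cut_at j (entries B) (entries C) (entries D) (entries E)"
    using interlock_order_cut_at[OF assms(1,2)] .
  have "perm_list \<beta>" "length \<beta> = length \<alpha>"
    using assms(1) perm_list_mset_cong[of \<alpha> \<beta>] unfolding \<alpha> \<beta> by (simp_all add: ac_simps)
  moreover have "cyc \<alpha> i \<noteq> i"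
    using cut_at_cyc_neq[OF _ cut] assms(1) ij unfolding \<alpha> by simp
  moreover have "cyc \<beta> = bypass j (bypass i (cyc \<alpha>))"
    using cut_at_cyc_interchange[OF _ cut] assms(1) ij unfolding \<alpha> \<beta> by simp
  ultimately show ?thesis using that ij by blast
qed

lemma cds_step:
  assumes "perm_list \<alpha>" and "cds p q \<alpha> \<beta>"
  obtains i j where "{p, q} = {(i, Suc i), (j, Suc j)}" "0 < i" "i < length \<alpha>" "0 < j" "j < length \<alpha>"
    "perm_list \<beta>" "length \<beta> = length \<alpha>" "cyc \<alpha> i \<noteq> i" "i \<noteq> j"
    "cyc \<beta> = bypass j (bypass i (cyc \<alpha>))"
proof -
  from assms(2) obtain A B C D E where
    "interlock_order p q \<alpha> A B C D E \<or> interlock_order q p \<alpha> A B C D E"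
    and \<beta>: "\<beta> = entries A @ entries D @ entries C @ entries B @ entries E"
    unfolding cds_def by blast
  then show ?thesis
  proof (elim disjE)
    assume "interlock_order p q \<alpha> A B C D E"
    then show ?thesis
      by (rule interlock_order_step[OF assms(1) _ \<beta>]) (rule that, simp_all)
  next
    assume "interlock_order q p \<alpha> A B C D E"
    then show ?thesis
      by (rule interlock_order_step[OF assms(1) _ \<beta>]) (rule that, simp_all add: insert_commute)
  qed
qed

text \<open>\<open>i\<close> and \<open>j\<close> differ from both end points of the walk from
  \<open>length \<alpha>\<close> to 0, so the two bypasses only delete points from its
  interior.\<close>

lemma strategic_pile_cds:
  assumes perm: "perm_list \<alpha>" and "cds p q \<alpha> \<beta>"
  shows "strategic_pile \<beta> = strategic_pile \<alpha> - {p, q}"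
proof -
  obtain i j where ij: "{p, q} = {(i, Suc i), (j, Suc j)}" "0 < i" "i < length \<alpha>" "0 < j" "j < length \<alpha>"
    "perm_list \<beta>" "length \<beta> = length \<alpha>" "cyc \<alpha> i \<noteq> i" "i \<noteq> j"
    "cyc \<beta> = bypass j (bypass i (cyc \<alpha>))"
    by (rule cds_step[OF assms])
  have ne: "\<alpha> \<noteq> []" "\<beta> \<noteq> []" using ij(3,7) by auto
  have inj: "inj (cyc \<alpha>)" using cyc_permutes[OF perm] by (rule permutes_inj)
  have "between (cyc \<beta>) (length \<alpha>) 0 = between (cyc \<alpha>) (length \<alpha>) 0 - {i} - {j}"
    unfolding ij(10) using ij(2,4) ij(3,5) inj by (simp add: between_bypass inj_bypass)
  then show ?thesis
    unfolding strategic_pile_eq[OF perm ne(1)] strategic_pile_eq[OF ij(6) ne(2)] ij(7) ij(1)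
    by auto
qed

text \<open>The size of this set is the measure that makes every play finite.\<close>

definition moved :: "nat list \<Rightarrow> nat set" where
  "moved \<alpha> = {k. cyc \<alpha> k \<noteq> k}"

lemma finite_moved: "perm_list \<alpha> \<Longrightarrow> finite (moved \<alpha>)"
  using cyc_permutes[of \<alpha>] unfolding moved_def permutes_def
  by (auto intro: finite_subset[of _ "{..length \<alpha>}"])

lemma card_moved_cds:
  assumes perm: "perm_list \<alpha>" and "cds p q \<alpha> \<beta>"
  shows "card (moved \<beta>) < card (moved \<alpha>)"
proof -
  obtain i j where ij: "{p, q} = {(i, Suc i), (j, Suc j)}" "0 < i" "i < length \<alpha>" "0 < j" "j < length \<alpha>"
    "perm_list \<beta>" "length \<beta> = length \<alpha>" "cyc \<alpha> i \<noteq> i" "i \<noteq> j"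
    "cyc \<beta> = bypass j (bypass i (cyc \<alpha>))"
    by (rule cds_step[OF assms])
  have "moved \<beta> \<subseteq> moved \<alpha>" unfolding moved_def ij(10) by (auto simp: bypass_def)
  moreover have "i \<in> moved \<alpha>" "i \<notin> moved \<beta>"
    using ij(8,9) unfolding moved_def ij(10) by (auto simp: bypass_def)
  ultimately have "moved \<beta> \<subset> moved \<alpha>" by blast
  then show ?thesis by (rule psubset_card_mono[OF finite_moved[OF perm]])
qed

section \<open>Isolated pointers and fixed points\<close>

lemma interlockI:
  assumes "marked \<alpha> = X @ [Ptr p] @ M @ [Ptr p] @ N" "Ptr q \<in> set M" "Ptr q \<in> set X \<union> set N"
    and "p \<in> pointers \<alpha>" "q \<in> pointers \<alpha>" "p \<noteq> q"
  shows "interlock p q \<alpha>"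
proof -
  obtain M1 M2 where M: "M = M1 @ Ptr q # M2" using assms(2) by (meson split_list)
  from assms(3) consider X1 X2 where "X = X1 @ Ptr q # X2" | N1 N2 where "N = N1 @ Ptr q # N2"
    by (meson Un_iff split_list)
  then show ?thesis
  proof cases
    case 1
    then have "interlock_order q p \<alpha> X1 X2 M1 M2 N"
      using assms M by (simp add: interlock_order_def)
    then show ?thesis unfolding interlock_def by blast
  next
    case 2
    then have "interlock_order p q \<alpha> X M1 M2 N1 N2"
      using assms M by (simp add: interlock_order_def)
    then show ?thesis unfolding interlock_def by blast
  qed
qed

text \<open>The two occurrences of the pointer split the marked list into an inside and an outside,
  and no other pointer occurs in both. Passing from \<open>k\<close> to \<open>k + 1\<close> or back
  thus never changes sides, except possibly at \<open>k = i\<close>.\<close>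

lemma isolated_pointer:
  assumes perm: "perm_list \<alpha>" and i: "0 < i" "i < length \<alpha>"
    and isolated: "\<And>q. \<not> interlock (i, Suc i) q \<alpha>"
  shows "cyc \<alpha> i = i \<or> (\<exists>Y. \<alpha> = Suc i # Y @ [i])"
proof -
  let ?n = "length \<alpha>" and ?p = "(i, Suc i)"
  have dist: "distinct \<alpha>" and set: "set \<alpha> = {1..?n}" using perm by (simp_all add: perm_list_def)
  have p: "?p \<in> pointers \<alpha>" using i by (simp add: pointers_def)
  have apart: False
    if "marked \<alpha> = X @ [Ptr ?p] @ M @ [Ptr ?p] @ N" "Ptr (k, Suc k) \<in> set M"
      "Ptr (k, Suc k) \<in> set X \<union> set N" "0 < k" "k < ?n" "k \<noteq> i" for X M N k
    using interlockI[OF that(1-3) p] that(4-) isolated by (auto simp: pointers_def)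
  have "i \<in> set \<alpha>" using i set by simp
  then obtain U V where UV: "\<alpha> = U @ i # V" by (meson split_list)
  have "Suc i \<in> set U \<union> set V"
  proof -
    have "Suc i \<in> set \<alpha>" using i set by simp
    then show ?thesis using UV by auto
  qed
  then consider X Y Z where "\<alpha> = X @ [Suc i] @ Y @ [i] @ Z" | X Y Z where "\<alpha> = X @ [i] @ Y @ [Suc i] @ Z"
    using UV by (auto dest!: split_list)
  then show ?thesis
  proof cases
    case 1
    let ?M = "Entry (Suc i) # Ptr (Suc i, Suc (Suc i)) # marked Y @ [Ptr (i - 1, i), Entry i]"
    have m: "marked \<alpha> = marked X @ [Ptr ?p] @ ?M @ [Ptr ?p] @ marked Z"
      unfolding 1 by simp
    let ?B = "insert i (insert (Suc i) (set Y))"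
    have heads: "Ptr (k, Suc k) \<in> set ?M" if "k \<in> ?B" "k \<noteq> i" for k
      using that by (auto dest: head_in_marked tail_in_marked)
    have tails: "Ptr (k, Suc k) \<in> set ?M" if "Suc k \<in> ?B" "k \<noteq> i" for k
      using that by (auto dest: head_in_marked tail_in_marked)
    have outside: "Ptr (k, Suc k) \<in> set (marked X) \<union> set (marked Z)"
      if "k \<in> set X \<union> set Z \<or> Suc k \<in> set X \<union> set Z" for k
      using that by (auto dest: head_in_marked tail_in_marked)
    have all: "k \<in> ?B \<union> (set X \<union> set Z)" if "1 \<le> k" "k \<le> ?n" for k
    proof -
      have "k \<in> set \<alpha>" using that set by simp
      then show ?thesis unfolding 1 by auto
    qed
    \<comment> \<open>With \<open>i + 1\<close> before \<open>i\<close>, both lie inside. Climbing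
      from \<open>i + 1\<close> and descending from \<open>i\<close> reaches all values, so the
      outside has no entries.\<close>
    have up: "Suc i \<le> k \<Longrightarrow> k \<le> ?n \<Longrightarrow> k \<in> ?B" for k
    proof (induction k rule: dec_induct)
      case (step k)
      then have "Ptr (k, Suc k) \<in> set ?M" using heads[of k] by auto
      then have "Suc k \<notin> set X \<union> set Z" using apart[OF m, of k] outside[of k] step by auto
      then show ?case using all[of "Suc k"] step by auto
    qed simp
    have down: "k \<le> i \<Longrightarrow> 1 \<le> k \<Longrightarrow> k \<in> ?B" for k
    proof (induction k rule: inc_induct)
      case (step k)
      then have "Ptr (k, Suc k) \<in> set ?M" using tails[of k] by auto
      then have "k \<notin> set X \<union> set Z" using apart[OF m, of k] outside[of k] step i by auto
      then show ?case using all[of k] step i by auto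
    qed simp
    have "k \<in> ?B" if "k \<in> set \<alpha>" for k
      using up[of k] down[of k] that set by (cases "k \<le> i") auto
    then have "set X \<union> set Z \<subseteq> ?B" unfolding 1 by auto
    moreover have "(set X \<union> set Z) \<inter> ?B = {}" using dist unfolding 1 by auto
    ultimately have "set X \<union> set Z = {}" by (metis inf.absorb1)
    then have "X = []" "Z = []" by simp_all
    then show ?thesis using 1 by auto
  next
    case 2
    have m: "marked \<alpha> = (marked X @ [Ptr (i - 1, i), Entry i]) @ [Ptr ?p] @ marked Y @ [Ptr ?p] @
        (Entry (Suc i) # Ptr (Suc i, Suc (Suc i)) # marked Z)" (is "_ = ?X @ _ @ _ @ _ @ ?Z")
      unfolding 2 by simp
    have dY: "i \<notin> set Y" "Suc i \<notin> set Y" using dist unfolding 2 by auto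
    have heads: "Ptr (k, Suc k) \<in> set (marked Y)" if "k \<in> set Y \<or> Suc k \<in> set Y" for k
      using that by (auto dest: head_in_marked tail_in_marked)
    have outside: "Ptr (k, Suc k) \<in> set ?X \<union> set ?Z"
      if "k \<in> insert (Suc i) (set X \<union> set Z) \<or> Suc k \<in> insert i (set X \<union> set Z)" for k
      using that by (auto dest: head_in_marked tail_in_marked)
    have all: "k \<in> insert i (insert (Suc i) (set Y \<union> (set X \<union> set Z)))" if "1 \<le> k" "k \<le> ?n" for k
    proof -
      have "k \<in> set \<alpha>" using that set by simp
      then show ?thesis unfolding 2 by auto
    qed
    have Suc: "Suc k \<in> set Y" if "k \<in> set Y" "0 < k" "k < ?n" for k
    proof -
      have "k \<noteq> i" using that dY by auto
      then have "Ptr (k, Suc k) \<notin> set ?X \<union> set ?Z"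
        using apart[OF m heads[of k]] that by blast
      then show ?thesis using outside[of k] all[of "Suc k"] that dY by auto
    qed
    have pred: "k \<in> set Y" if "Suc k \<in> set Y" "0 < k" "k < ?n" for k
    proof -
      have "k \<noteq> i" using that dY by auto
      then have "Ptr (k, Suc k) \<notin> set ?X \<union> set ?Z"
        using apart[OF m heads[of k]] that by blast
      then show ?thesis using outside[of k] all[of k] that dY by auto
    qed
    \<comment> \<open>An entry strictly between \<open>i\<close> and \<open>i + 1\<close> would
      force, step by step, \<open>i\<close> or \<open>i + 1\<close> itself to lie in
      \<open>Y\<close>.\<close>
    have "Y = []"
    proof (rule ccontr)
      assume "Y \<noteq> []"
      then obtain k where k: "k \<in> set Y" by (cases Y) auto
      then have kn: "k \<in> {1..?n}" using set 2 by auto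
      show False
      proof (cases "k \<le> i")
        case True
        have "k \<le> l \<Longrightarrow> l \<le> i \<Longrightarrow> l \<in> set Y" for l
          by (induction l rule: dec_induct) (use k kn i Suc in auto)
        then show False using True dY by auto
      next
        case False
        have "l \<le> k \<Longrightarrow> Suc i \<le> l \<Longrightarrow> l \<in> set Y" for l
          by (induction l rule: inc_induct) (use k kn i pred in auto)
        then show False using False dY by auto
      qed
    qed
    then have "cyc \<alpha> i = i"
      using dist unfolding 2 by (auto simp: cyc_def pred_in_append)
    then show ?thesis ..
  qed
qed

text \<open>The walk is just \<open>n\<close>, \<open>i\<close>, 0: the last entry is
  \<open>i\<close>, and \<open>i + 1\<close> has the sentinel 0 on its left.\<close>

lemma strategic_pile_ends:
  assumes perm: "perm_list \<alpha>" and \<alpha>: "\<alpha> = Suc i # Y @ [i]"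
  shows "strategic_pile \<alpha> = {(i, Suc i)}"
proof -
  let ?n = "length \<alpha>"
  have "i \<in> set \<alpha>" unfolding \<alpha> by simp
  then have i: "0 < i" using perm by (simp add: perm_list_def)
  have "Suc ?n \<notin> set \<alpha>" using perm by (simp add: perm_list_def)
  then have n: "cyc \<alpha> ?n = last (0 # \<alpha>)"
    unfolding cyc_def pred_in_append by auto
  also have "\<dots> = i" by (simp add: \<alpha>)
  finally have 1: "cyc \<alpha> ?n = i" .
  have 2: "cyc \<alpha> i = 0" by (simp add: \<alpha> cyc_def)
  have "visited (cyc \<alpha>) ?n 0 = (\<lambda>k. (cyc \<alpha> ^^ k) ?n) ` {1..2}"
  proof (rule visited_funpow)
    fix k :: nat assume "0 < k" "k < 2"
    then have "k = 1" by simp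
    then show "(cyc \<alpha> ^^ k) ?n \<noteq> 0" using 1 i by simp
  qed (simp_all add: numeral_2_eq_2 1 2)
  also have "{1..2} = {1, 2 :: nat}" by auto
  finally have "visited (cyc \<alpha>) ?n 0 = {i, 0}" by (simp add: numeral_2_eq_2 1 2)
  then have "between (cyc \<alpha>) ?n 0 = {i}" using i by (auto simp: between_def)
  moreover have "\<alpha> \<noteq> []" by (simp add: \<alpha>)
  ultimately show ?thesis using strategic_pile_eq[OF perm] by simp
qed

text \<open>Points of the pile are visited, hence not fixed by \<open>cyc\<close>, which leaves only
  the surrounding case of \<open>isolated_pointer\<close>.\<close>

lemma strategic_pile_isolated:
  assumes perm: "perm_list \<alpha>" and p: "p \<in> strategic_pile \<alpha>" and isolated: "\<And>q. \<not> interlock p q \<alpha>"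
  shows "strategic_pile \<alpha> = {p}"
proof -
  obtain i where i: "p = (i, Suc i)" "0 < i" "i < length \<alpha>"
    using p by (auto simp: strategic_pile_def pointers_def)
  have ne: "\<alpha> \<noteq> []" using i by auto
  have "i \<in> visited (cyc \<alpha>) (length \<alpha>) 0"
    using p i strategic_pile_eq[OF perm ne] by (auto simp: between_def split: if_splits)
  then have "cyc \<alpha> i \<noteq> i"
    using fixpoint_notin_visited[OF permutes_inj[OF cyc_permutes[OF perm]], of i "length \<alpha>"] i by auto
  then show ?thesis
    using isolated_pointer[OF perm i(2,3)] isolated strategic_pile_ends[OF perm] i by auto
qed

section \<open>Runs of adjacencies and the shape of fixed points\<close>

lemma next_entry:
  assumes perm: "perm_list \<alpha>" and "cyc \<alpha> m = m" "k < length \<alpha>" "\<alpha> ! k = m" "m < length \<alpha>"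
  shows "Suc k < length \<alpha> \<and> \<alpha> ! Suc k = Suc m"
proof -
  let ?b = "\<alpha> @ [Suc (length \<alpha>)]"
  have dist: "distinct \<alpha>" and set: "set \<alpha> = {1..length \<alpha>}" using perm by (simp_all add: perm_list_def)
  have db: "distinct ?b" using perm_list_sentinels[OF perm] by simp
  have "Suc m \<in> set \<alpha>" using assms(5) set by simp
  then obtain l where l: "l < length \<alpha>" "\<alpha> ! l = Suc m" by (auto simp: in_set_conv_nth)
  have "m \<in> set \<alpha>" using assms(3,4) nth_mem by blast
  then have "0 < m" using set by simp
  have "(0 # ?b) ! l = m"
    using pred_in_nth[OF db, of l 0] l assms(2) by (simp add: nth_append cyc_def)
  \<comment> \<open>\<open>l = 0\<close> would make the left neighbour 0 rather than
    \<open>m\<close>.\<close>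
  then obtain l' where l': "l = Suc l'" "?b ! l' = m" using \<open>0 < m\<close> by (cases l) auto
  then have "\<alpha> ! l' = \<alpha> ! k" "l' < length \<alpha>" using assms(4) l by (auto simp: nth_append)
  then have "l' = k" using dist assms(3) nth_eq_iff_index_eq by blast
  then show ?thesis using l l' by simp
qed

lemma next_entries:
  assumes perm: "perm_list \<alpha>" and fixed: "\<And>m. x \<le> m \<Longrightarrow> m < y \<Longrightarrow> cyc \<alpha> m = m"
    and k: "k < length \<alpha>" "\<alpha> ! k = x" and y: "y \<le> length \<alpha>"
  shows "x + l \<le> y \<Longrightarrow> k + l < length \<alpha> \<and> \<alpha> ! (k + l) = x + l"
proof (induction l)
  case (Suc l)
  then show ?case using next_entry[OF perm fixed[of "x + l"], of "k + l"] y by auto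
qed (use k in simp)

text \<open>Every pointer is an adjacency or surrounds the list. If none surrounds it, the list is
  the identity, which is excluded; otherwise the surrounding pointer of \<open>i\<close> splits the
  values into the two runs from \<open>i + 1\<close> to \<open>n\<close> and from 1 to
  \<open>i\<close>.\<close>

lemma cds_fixed_point_has_code:
  assumes perm: "perm_list \<alpha>" and fp: "cds_fixed_point \<alpha>" and ns: "\<alpha> \<noteq> [1..<Suc (length \<alpha>)]"
  shows "\<exists>p. has_code \<alpha> p"
proof -
  let ?n = "length \<alpha>"
  have set: "set \<alpha> = {1..?n}" using perm by (simp add: perm_list_def)
  have isolated: "cyc \<alpha> i = i \<or> (\<exists>Y. \<alpha> = Suc i # Y @ [i])" if "0 < i" "i < ?n" for i
    using isolated_pointer[OF perm that] fp by (auto simp: cds_fixed_point_def)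
  have "\<alpha> \<noteq> []" using ns by auto
  then have "1 \<in> set \<alpha>" unfolding set by (simp add: Suc_leI)
  then obtain o1 where o1: "o1 < ?n" "\<alpha> ! o1 = 1" by (auto simp: in_set_conv_nth)
  show ?thesis
  proof (cases "\<exists>i Y. \<alpha> = Suc i # Y @ [i]")
    case False
    then have "cyc \<alpha> m = m" if "1 \<le> m" "m < ?n" for m using isolated that by auto
    note * = next_entries[OF perm this o1 order_refl]
    \<comment> \<open>A run of \<open>?n\<close> entries starting at position \<open>o1\<close> fits
      only if \<open>o1 = 0\<close>.\<close>
    have "1 + (?n - 1) \<le> ?n" using o1(1) by simp
    then have "o1 = 0" using *[of "?n - 1"] by linarith
    then have "\<alpha> = [1..<Suc ?n]" using * by (intro nth_equalityI) (simp_all del: upt_Suc)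
    with ns show ?thesis by contradiction
  next
    case True
    then obtain i Y where \<alpha>: "\<alpha> = Suc i # Y @ [i]" by blast
    have "i \<in> set \<alpha>" "Suc i \<in> set \<alpha>" by (simp_all add: \<alpha>)
    then have i: "0 < i" "i < ?n" using set by auto
    have fixed: "cyc \<alpha> m = m" if "0 < m" "m < ?n" "m \<noteq> i" for m
      using isolated[OF that(1,2)] that(3) \<alpha> by auto
    have hd: "\<alpha> ! 0 = Suc i" by (simp add: \<alpha>)
    have up: "\<alpha> ! l = Suc i + l" if "Suc i + l \<le> ?n" for l
      using next_entries[OF perm _ _ hd order_refl, of l] fixed that i by force
    have low: "o1 + l < ?n \<and> \<alpha> ! (o1 + l) = 1 + l" if "1 + l \<le> i" for l
      using next_entries[OF perm _ o1, of i l] fixed that i by auto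
    \<comment> \<open>The upper run fills the first \<open>?n - i\<close> positions, so 1 comes
      later; the lower run of \<open>i\<close> entries must still fit, which determines
      \<open>o1\<close>.\<close>
    have "o1 \<ge> ?n - i"
    proof (rule ccontr)
      assume "\<not> o1 \<ge> ?n - i"
      then have "Suc i + o1 \<le> ?n" by simp
      then show False using up[of o1] o1 i by simp
    qed
    moreover have "o1 + (i - 1) < ?n" using low[of "i - 1"] i by simp
    ultimately have o1_eq: "o1 = ?n - i" using i by simp
    have "\<alpha> = [Suc i..<Suc ?n] @ [1..<Suc i]"
    proof (rule nth_equalityI)
      fix l assume l: "l < ?n"
      show "\<alpha> ! l = ([Suc i..<Suc ?n] @ [1..<Suc i]) ! l"
      proof (cases "l < ?n - i")
        case True
        then show ?thesis using up[of l] by (simp add: nth_append del: upt_Suc)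
      next
        case False
        then show ?thesis using low[of "l - o1"] l i o1_eq by (simp add: nth_append del: upt_Suc)
      qed
    qed (use i in simp)
    then have "has_code \<alpha> (i, Suc i)"
      unfolding has_code_def using i by (intro exI[of _ "Suc i"]) (simp del: upt_Suc)
    then show ?thesis ..
  qed
qed

lemma strategic_pile_has_code:
  assumes perm: "perm_list \<alpha>" and "has_code \<alpha> p"
  shows "strategic_pile \<alpha> = {p}"
proof -
  obtain i where i: "2 \<le> i" "i \<le> length \<alpha>" "\<alpha> = [i..<Suc (length \<alpha>)] @ [1..<i]" "p = (i - 1, i)"
    using assms(2) unfolding has_code_def by blast
  have "[i..<Suc (length \<alpha>)] = i # [Suc i..<Suc (length \<alpha>)]" using i by (simp add: upt_conv_Cons del: upt_Suc)
  moreover have "[1..<i] = [1..<i - 1] @ [i - 1]" using i(1) upt_Suc_append[of 1 "i - 1"] by simp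
  ultimately have "\<alpha> = Suc (i - 1) # ([Suc i..<Suc (length \<alpha>)] @ [1..<i - 1]) @ [i - 1]"
    using i by (metis Suc_diff_1 append_Cons append_assoc less_le_trans zero_less_numeral)
  from strategic_pile_ends[OF perm this] show ?thesis using i by simp
qed

section \<open>The game\<close>

text \<open>\<open>V\<close> and \<open>W\<close> are invariants for the positions where
  \<open>X\<close>, respectively the opponent, is to move; ONE moves first, hence the case
  distinction on the start. The measure \<open>\<mu>\<close> excludes infinite plays.\<close>

lemma winning_strategyI:
  assumes \<alpha>: "\<alpha> \<in> (if X = ONE then V else W)"
    and V: "\<And>\<beta>. \<beta> \<in> V \<Longrightarrow> \<not> cds_fixed_point \<beta> \<Longrightarrow>
      \<exists>p q. interlock p q \<beta> \<and> (\<forall>\<gamma>. cds p q \<beta> \<gamma> \<longrightarrow> \<gamma> \<in> W)"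
    and W: "\<And>\<beta> \<gamma>. \<beta> \<in> W \<Longrightarrow> cds_move \<beta> \<gamma> \<Longrightarrow> \<gamma> \<in> V"
    and won: "\<And>\<beta>. \<beta> \<in> V \<union> W \<Longrightarrow> cds_fixed_point \<beta> \<Longrightarrow> wins X A \<beta>"
    and measure: "\<And>\<beta> \<gamma>. \<beta> \<in> V \<union> W \<Longrightarrow> cds_move \<beta> \<gamma> \<Longrightarrow> (\<mu> \<gamma> :: nat) < \<mu> \<beta>"
  shows "has_winning_strategy X \<alpha> A"
proof -
  have "\<forall>\<beta>. \<exists>pq. \<beta> \<in> V \<and> \<not> cds_fixed_point \<beta> \<longrightarrow>
      (case pq of (p, q) \<Rightarrow> interlock p q \<beta> \<and> (\<forall>\<gamma>. cds p q \<beta> \<gamma> \<longrightarrow> \<gamma> \<in> W))"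
    using V by fast
  then obtain s where s: "\<forall>\<beta>. \<beta> \<in> V \<and> \<not> cds_fixed_point \<beta> \<longrightarrow>
      (case s \<beta> of (p, q) \<Rightarrow> interlock p q \<beta> \<and> (\<forall>\<gamma>. cds p q \<beta> \<gamma> \<longrightarrow> \<gamma> \<in> W))"
    by (rule choice[THEN exE])
  \<comment> \<open>A positional choice suffices: only the last entry of the history is
    consulted.\<close>
  define \<sigma> where "\<sigma> h = s (last h)" for h
  have inv: "h ! i \<in> (if to_move i = X then V else W)"
    if h: "play \<alpha> h" "follows X \<sigma> h" and "i < length h" for h i
    using that(3)
  proof (induction i)
    case 0
    then show ?case using h(1) \<alpha> by (cases X) (auto simp: play_def to_move_def hd_conv_nth)
  next
    case (Suc i)
    have move: "cds_move (h ! i) (h ! Suc i)" using h(1) Suc.prems by (auto simp: play_def)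
    have turn: "to_move (Suc i) = X \<longleftrightarrow> to_move i \<noteq> X"
      by (cases X) (auto simp: to_move_def)
    show ?case
    proof (cases "to_move i = X")
      case True
      then have V: "h ! i \<in> V" using Suc by simp
      \<comment> \<open>The play continues after \<open>h ! i\<close>, so a pair interlocks there
        and the specification of \<open>s\<close> applies.\<close>
      have "\<not> cds_fixed_point (h ! i)"
        using move unfolding cds_move_def cds_def cds_fixed_point_def interlock_def by blast
      with V have "case s (h ! i) of (p, q) \<Rightarrow>
          interlock p q (h ! i) \<and> (\<forall>\<gamma>. cds p q (h ! i) \<gamma> \<longrightarrow> \<gamma> \<in> W)"
        using s[rule_format, of "h ! i"] by simp
      moreover have "case \<sigma> (take (Suc i) h) of (p, q) \<Rightarrow> cds p q (h ! i) (h ! Suc i)"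
        using h(2)[unfolded follows_def, rule_format, of i] True Suc.prems by simp
      moreover have "last (take (Suc i) h) = h ! i"
        using Suc.prems by (simp add: take_Suc_conv_app_nth)
      ultimately have "h ! Suc i \<in> W" by (auto simp: \<sigma>_def split: prod.splits)
      then show ?thesis using turn True by simp
    next
      case False
      then show ?thesis using Suc W[OF _ move] turn by simp
    qed
  qed
  have "winning_strategy X \<alpha> A \<sigma>"
    unfolding winning_strategy_def
  proof (intro conjI allI impI notI)
    fix h assume h: "play \<alpha> h \<and> follows X \<sigma> h"
    then have ne: "h \<noteq> []" by (simp add: play_def)
    then have last: "last h = h ! (length h - 1)" by (rule last_conv_nth)
    have *: "last h \<in> (if to_move (length h - 1) = X then V else W)"
      unfolding last using inv[of h "length h - 1"] h ne by simp
    show "if cds_fixed_point (last h) then wins X A (last h)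
      else to_move (length h - 1) = X \<longrightarrow> (case \<sigma> h of (p, q) \<Rightarrow> interlock p q (last h))"
    proof (cases "cds_fixed_point (last h)")
      case True
      then show ?thesis using won[of "last h"] * by (auto split: if_splits)
    next
      case False
      then show ?thesis using s[rule_format, of "last h"] * by (auto simp: \<sigma>_def split: if_splits)
    qed
  next
    assume "\<exists>f. \<forall>m. play \<alpha> (map f [0..<Suc m]) \<and> follows X \<sigma> (map f [0..<Suc m])"
    then obtain f where f: "\<And>m. play \<alpha> (map f [0..<Suc m])" "\<And>m. follows X \<sigma> (map f [0..<Suc m])"
      by blast
    have "\<mu> (f (Suc m)) < \<mu> (f m)" for m
    proof (rule measure)
      have "map f [0..<Suc m] ! m \<in> (if to_move m = X then V else W)"
        by (rule inv[OF f]) simp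
      then show "f m \<in> V \<union> W" by (auto simp del: upt_Suc split: if_splits)
      have "cds_move (map f [0..<Suc (Suc m)] ! m) (map f [0..<Suc (Suc m)] ! Suc m)"
        using f(1)[of "Suc m"] unfolding play_def by (simp del: upt_Suc)
      then show "cds_move (f m) (f (Suc m))" by (simp del: upt_Suc)
    qed
    then have "(f (Suc m), f m) \<in> measure \<mu>" for m by simp
    then show False using wf_measure[of \<mu>] unfolding wf_iff_no_infinite_down_chain by blast
  qed
  then show ?thesis unfolding has_winning_strategy_def by blast
qed

section \<open>Non-sortable positions and counting in the pile\<close>

lemma finite_strategic_pile: "finite (strategic_pile \<alpha>)"
proof (rule finite_subset)
  show "strategic_pile \<alpha> \<subseteq> {..length \<alpha>} \<times> {..length \<alpha>}"
    by (auto simp: strategic_pile_def pointers_def)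
qed simp

definition nonsortable :: "nat list \<Rightarrow> bool" where
  "nonsortable \<alpha> \<longleftrightarrow> perm_list \<alpha> \<and> \<not> cds_sortable \<alpha>"

text \<open>Prefixing the move to a sorting sequence for \<open>\<beta>\<close> would sort
  \<open>\<alpha>\<close>.\<close>

lemma nonsortable_cds:
  assumes "nonsortable \<alpha>" "cds p q \<alpha> \<beta>"
  shows "nonsortable \<beta>"
proof -
  have perm: "perm_list \<alpha>" using assms(1) by (simp add: nonsortable_def)
  have \<beta>: "perm_list \<beta>" "length \<beta> = length \<alpha>" by (rule cds_step[OF perm assms(2)], assumption)+
  have "cds_move \<alpha> \<beta>" using assms(2) unfolding cds_move_def by blast
  then have "cds_sortable \<alpha>" if "cds_sortable \<beta>"
    using that unfolding cds_sortable_def \<beta>(2) by (rule converse_rtranclp_into_rtranclp)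
  then show ?thesis using assms(1) \<beta> by (auto simp: nonsortable_def)
qed

lemma nonsortable_fixed_point:
  assumes "nonsortable \<alpha>" "cds_fixed_point \<alpha>"
  obtains p where "has_code \<alpha> p" "strategic_pile \<alpha> = {p}"
proof -
  have perm: "perm_list \<alpha>" using assms(1) by (simp add: nonsortable_def)
  have "\<alpha> \<noteq> [1..<Suc (length \<alpha>)]"
    using assms(1) unfolding nonsortable_def cds_sortable_def by (metis rtranclp.rtrancl_refl)
  then show ?thesis
    using that cds_fixed_point_has_code[OF perm assms(2)] strategic_pile_has_code[OF perm] by blast
qed

lemma card_pile_cds:
  assumes "nonsortable \<alpha>" "cds p q \<alpha> \<beta>"
  shows "card (strategic_pile \<beta> \<inter> G) \<le> card (strategic_pile \<alpha> \<inter> G)"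
    "card (strategic_pile \<alpha> \<inter> G) \<le> card (strategic_pile \<beta> \<inter> G) + card ({p, q} \<inter> G)"
proof -
  have \<beta>: "strategic_pile \<beta> = strategic_pile \<alpha> - {p, q}"
    using strategic_pile_cds[OF _ assms(2)] assms(1) by (simp add: nonsortable_def)
  show "card (strategic_pile \<beta> \<inter> G) \<le> card (strategic_pile \<alpha> \<inter> G)"
    by (rule card_mono) (auto simp: \<beta> finite_strategic_pile)
  have "strategic_pile \<alpha> \<inter> G \<subseteq> (strategic_pile \<beta> \<inter> G) \<union> ({p, q} \<inter> G)" by (auto simp: \<beta>)
  then have "card (strategic_pile \<alpha> \<inter> G) \<le> card ((strategic_pile \<beta> \<inter> G) \<union> ({p, q} \<inter> G))"
    by (intro card_mono) (auto simp: finite_strategic_pile)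
  also have "\<dots> \<le> card (strategic_pile \<beta> \<inter> G) + card ({p, q} \<inter> G)" by (rule card_Un_le)
  finally show "card (strategic_pile \<alpha> \<inter> G) \<le> card (strategic_pile \<beta> \<inter> G) + card ({p, q} \<inter> G)" .
qed

definition target :: "player \<Rightarrow> ptr set \<Rightarrow> ptr set" where
  "target X A = (if X = ONE then A else - A)"

text \<open>Victory of TWO is a negative statement, so it needs uniqueness of the code, which the
  singleton pile determines.\<close>

lemma wins_fixed_point:
  assumes "nonsortable \<beta>" "cds_fixed_point \<beta>" "strategic_pile \<beta> \<inter> target X A \<noteq> {}"
  shows "wins X A \<beta>"
proof -
  obtain p where p: "has_code \<beta> p" "strategic_pile \<beta> = {p}"
    using nonsortable_fixed_point[OF assms(1,2)] .
  have unique: "q = p" if "has_code \<beta> q" for q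
    using strategic_pile_has_code[OF _ that] assms(1) p(2) by (simp add: nonsortable_def)
  have mem: "p \<in> target X A" using assms(3) p(2) by simp
  show ?thesis
  proof (cases X)
    case ONE
    then show ?thesis using p(1) mem by (auto simp: target_def)
  next
    case TWO
    then show ?thesis using unique mem by (auto simp: target_def)
  qed
qed

text \<open>Let \<open>g\<close> and \<open>b\<close> be the numbers of elements of the strategic pile that are good and bad for
  \<open>X\<close>. As long as \<open>b > 0\<close>, player \<open>X\<close> removes a bad element and thereby at most one good one,
  while the opponent removes at most two good ones; so \<open>3 * b \<le> g + 2\<close> persists at each turn
  of \<open>X\<close>, and \<open>3 * b \<le> g\<close> at each turn of the opponent.\<close>

lemma has_winning_strategy_if_card:
  fixes X :: player and A :: "ptr set"
  defines "G \<equiv> target X A"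
  assumes ns: "nonsortable \<alpha>"
    and card: "3 * card (strategic_pile \<alpha> \<inter> - G) \<le> card (strategic_pile \<alpha> \<inter> G) + (if X = ONE then 2 else 0)"
  shows "has_winning_strategy X \<alpha> A"
proof -
  let ?g = "\<lambda>\<beta>. card (strategic_pile \<beta> \<inter> G)" and ?b = "\<lambda>\<beta>. card (strategic_pile \<beta> \<inter> - G)"
  let ?V = "{\<beta>. nonsortable \<beta> \<and> 3 * ?b \<beta> \<le> ?g \<beta> + 2}"
  let ?W = "{\<beta>. nonsortable \<beta> \<and> 3 * ?b \<beta> \<le> ?g \<beta>}"
  show ?thesis
  proof (rule winning_strategyI[where V = ?V and W = ?W and \<mu> = "\<lambda>\<beta>. card (moved \<beta>)"])
    show "\<alpha> \<in> (if X = ONE then ?V else ?W)" using ns card by auto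
  next
    fix \<beta> assume \<beta>: "\<beta> \<in> ?V" and nfp: "\<not> cds_fixed_point \<beta>"
    then have ns: "nonsortable \<beta>" and le: "3 * ?b \<beta> \<le> ?g \<beta> + 2" by simp_all
    show "\<exists>p q. interlock p q \<beta> \<and> (\<forall>\<gamma>. cds p q \<beta> \<gamma> \<longrightarrow> \<gamma> \<in> ?W)"
    proof (cases "?b \<beta> = 0")
      case True
      obtain p q where "interlock p q \<beta>" using nfp by (auto simp: cds_fixed_point_def)
      moreover have "\<gamma> \<in> ?W" if "cds p q \<beta> \<gamma>" for \<gamma>
        using card_pile_cds(1)[OF ns that, of "- G"] True nonsortable_cds[OF ns that] by simp
      ultimately show ?thesis by blast
    next
      case False
      then have "strategic_pile \<beta> \<inter> - G \<noteq> {}" by (metis card.empty)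
      then obtain p where p: "p \<in> strategic_pile \<beta>" "p \<notin> G" by blast
      \<comment> \<open>A bad element gives \<open>3 \<le> ?g \<beta> + 2\<close>, so a good one is
        left as well; hence \<open>p\<close> is not the whole pile and must interlock with
        something.\<close>
      have "?g \<beta> \<noteq> 0" using le False by simp
      then have "strategic_pile \<beta> \<noteq> {p}" using p by auto
      then obtain q where q: "interlock p q \<beta>"
        using strategic_pile_isolated[OF _ p(1)] ns by (auto simp: nonsortable_def)
      moreover have "\<gamma> \<in> ?W" if \<gamma>: "cds p q \<beta> \<gamma>" for \<gamma>
      proof -
        have \<gamma>_pile: "strategic_pile \<gamma> = strategic_pile \<beta> - {p, q}"
          using strategic_pile_cds[OF _ \<gamma>] ns by (simp add: nonsortable_def)
        have "?b \<gamma> < ?b \<beta>"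
          by (rule psubset_card_mono) (use p in \<open>auto simp: \<gamma>_pile finite_strategic_pile\<close>)
        \<comment> \<open>The bad count drops by at least one and the good count by at most one, so
          the slack 2 is recovered: \<open>3 * (b - 1) \<le> g - 1\<close>.\<close>
        moreover have "card ({p, q} \<inter> G) \<le> card {q}"
          by (rule card_mono) (use p in auto)
        ultimately have "3 * ?b \<gamma> \<le> ?g \<gamma>"
          using card_pile_cds(2)[OF ns \<gamma>, of G] le by simp
        then show ?thesis using nonsortable_cds[OF ns \<gamma>] by simp
      qed
      ultimately show ?thesis by blast
    qed
  next
    fix \<beta> \<gamma> assume \<beta>: "\<beta> \<in> ?W" and "cds_move \<beta> \<gamma>"
    then obtain p q where \<gamma>: "cds p q \<beta> \<gamma>" by (auto simp: cds_move_def)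
    have ns: "nonsortable \<beta>" and le: "3 * ?b \<beta> \<le> ?g \<beta>" using \<beta> by simp_all
    have "card ({p, q} \<inter> G) \<le> card {p, q}" by (rule card_mono) auto
    also have "\<dots> \<le> 2" by (simp add: card_insert_if)
    finally have "card ({p, q} \<inter> G) \<le> 2" .
    then show "\<gamma> \<in> ?V"
      using card_pile_cds(1)[OF ns \<gamma>, of "- G"] card_pile_cds(2)[OF ns \<gamma>, of G] le
        nonsortable_cds[OF ns \<gamma>] by simp
  next
    fix \<beta> assume \<beta>: "\<beta> \<in> ?V \<union> ?W" and fp: "cds_fixed_point \<beta>"
    then have ns: "nonsortable \<beta>" by auto
    obtain p where p: "strategic_pile \<beta> = {p}" using nonsortable_fixed_point[OF ns fp] .
    have "p \<in> G"
    \<comment> \<open>A single bad element would violate even the weaker invariant, as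
      \<open>3 * 1 > 0 + 2\<close>.\<close>
    proof (rule ccontr)
      assume "p \<notin> G"
      then have "?b \<beta> = 1" "?g \<beta> = 0" by (simp_all add: p)
      then show False using \<beta> by auto
    qed
    then show "wins X A \<beta>" using wins_fixed_point[OF ns fp, of X A] p by (simp add: G_def)
  next
    fix \<beta> \<gamma> assume "\<beta> \<in> ?V \<union> ?W" and "cds_move \<beta> \<gamma>"
    then show "card (moved \<gamma>) < card (moved \<beta>)"
      using card_moved_cds by (auto simp: cds_move_def nonsortable_def)
  qed
qed

theorem theorem8:
  fixes n j :: nat and \<alpha> :: "nat list" and P :: "ptr set"
  assumes "\<alpha> \<in> permutations_of_set {1..n}"
    and "\<not> cds_sortable \<alpha>"
    and "P = strategic_pile \<alpha>"
    and "j = card P mod 4"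
  shows
    "(j < 2 \<longrightarrow> (\<forall>A \<subseteq> P.
        real (card A) \<ge> 3 / 4 * (real (card P) - real j) + real j \<longrightarrow>
        has_winning_strategy ONE \<alpha> A)) \<and>
     (j \<ge> 2 \<longrightarrow> (\<forall>A \<subseteq> P.
        real (card A) \<ge> 3 / 4 * (real (card P) - real j) + (real j - 1) \<longrightarrow>
        has_winning_strategy ONE \<alpha> A)) \<and>
     (\<forall>A \<subseteq> P.
        real (card (P - A)) \<ge> 3 / 4 * (real (card P) - real j) + real j \<longrightarrow>
        has_winning_strategy TWO \<alpha> A)"
proof -
  have "length \<alpha> = n" using length_finite_permutations_of_set[OF assms(1)] by simp
  then have ns: "nonsortable \<alpha>"
    using assms(1,2) by (auto simp: nonsortable_def perm_list_def permutations_of_set_def)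
  have fin: "finite P" by (simp add: assms(3) finite_strategic_pile)
  \<comment> \<open>With \<open>card P = 4 * k + j\<close> the thresholds become
    \<open>3 * k + j\<close> and \<open>3 * k + j - 1\<close>.\<close>
  define k where "k = card P div 4"
  have P: "card P = 4 * k + j" by (simp add: k_def assms(4))
  then have quarter: "3 / 4 * (real (card P) - real j) = 3 * real k" by simp
  have split: "card P = card A + card (P - A)" if "A \<subseteq> P" for A
    using that fin by (metis card_Diff_subset card_mono finite_subset le_add_diff_inverse)
  have one: "has_winning_strategy ONE \<alpha> A" if "A \<subseteq> P" "3 * card (P - A) \<le> card A + 2" for A
    using has_winning_strategy_if_card[OF ns, of ONE A] that assms(3)
    by (simp add: target_def Int_absorb1 Diff_eq[symmetric])
  have two: "has_winning_strategy TWO \<alpha> A" if "A \<subseteq> P" "3 * card A \<le> card (P - A)" for A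
    using has_winning_strategy_if_card[OF ns, of TWO A] that assms(3)
    by (simp add: target_def Int_absorb1 Diff_eq[symmetric])
  have "j < 4" by (simp add: assms(4))
  show ?thesis
    unfolding quarter
  proof (intro conjI impI allI)
    fix A assume "j < 2" "A \<subseteq> P" "3 * real k + real j \<le> real (card A)"
    then show "has_winning_strategy ONE \<alpha> A"
      using split[of A] P by (intro one) linarith+
  next
    fix A assume *: "2 \<le> j" "A \<subseteq> P" "3 * real k + (real j - 1) \<le> real (card A)"
    \<comment> \<open>Now \<open>P - A\<close> may have \<open>k + 1\<close> elements, and
      \<open>3 * (k + 1) \<le> (3 * k + j - 1) + 2\<close> is where \<open>2 \<le> j\<close> enters.
      Writing the bound with \<open>+ 1\<close> avoids truncated subtraction.\<close>
    then have "3 * k + j \<le> card A + 1" by linarith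
    then show "has_winning_strategy ONE \<alpha> A"
      using * split[of A] P \<open>j < 4\<close> by (intro one) linarith+
  next
    fix A assume "A \<subseteq> P" "3 * real k + real j \<le> real (card (P - A))"
    then show "has_winning_strategy TWO \<alpha> A"
      using split[of A] P by (intro two) linarith+
  qed
qed

end
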